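(* Let $\mathbb{k}$ be a field containing $\mathbb{Q}$, and let $\mathcal{T}=(A,B,\varepsilon)$ be a commutative triple, i.e. $A$ and $B$ are commutative unital $\mathbb{k}$-algebras and $\varepsilon:B\to A$ is a morphism of $\mathbb{k}$-algebras. Let $HC_1(A,B,\varepsilon)$ be the first secondary cyclic homology of the triple and $\Omega^1_{\mathcal{T}|\mathbb{k}}$ its module of secondary Kähler differentials, as defined in the context. Then there is an isomorphism of $\mathbb{k}$-vector spaces $$HC_1(A,B,\varepsilon)\cong\frac{\Omega^1_{\mathcal{T}|\mathbb{k}}}{d(1\otimes A)},$$ where $d(1\otimes A)=\{d(1\otimes a): a\in A\}\subseteq\Omega^1_{\mathcal{T}|\mathbb{k}}$.
   Context: All tensor products are over the field $\mathbb{k}\supseteq\mathbb{Q}$. Algebras are associative and unital, and algebra morphisms preserve units. Here $A$ and $B$ are commutative. **Notation.** An elementary tensor of $A^{\otimes 2}\otimes B$ is written $\otimes\begin{pmatrix} a & \alpha\\ 1 & b\end{pmatrix}$ with $a,b\in A$, $\alpha\in B$. An elementary tensor of $A^{\otimes 3}\otimes B^{\otimes 3}$ is written $\otimes\begin{pmatrix} a & \alpha & \beta\\ 1 & b & \gamma\\ 1 & 1 & c\end{pmatrix}$ with $a,b,c\in A$, $\alpha,\beta,\gamma\in B$. **Secondary Hochschild complex.** It has degree $n$ term $\overline{C}_n=A^{\otimes (n+1)}\otimes B^{\otimes n(n+1)/2}$. In low degrees it reads $$\cdots\to \overline{C}_2=A^{\otimes 3}\otimes B^{\otimes 3}\xrightarrow{\partial_2}\overline{C}_1=A^{\otimes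 2}\otimes B\xrightarrow{\partial_1}\overline{C}_0=A\to 0,$$ with $\mathbb{k}$-linear maps determined by $$\partial_1\Big(\otimes\begin{pmatrix} a & \alpha\\ 1 & b\end{pmatrix}\Big)=a\varepsilon(\alpha)b-b\varepsilon(\alpha)a,$$ $$\partial_2\Big(\otimes\begin{pmatrix} a & \alpha & \beta\\ 1 & b & \gamma\\ 1 & 1 & c\end{pmatrix}\Big)=\otimes\begin{pmatrix} a\varepsilon(\alpha)b & \beta\gamma\\ 1 & c\end{pmatrix}-\otimes\begin{pmatrix} a & \alpha\beta\\ 1 & b\varepsilon(\gamma)c\end{pmatrix}+\otimes\begin{pmatrix} c\varepsilon(\beta)a & \alpha\gamma\\ 1 & b\end{pmatrix}.$$ **Secondary cyclic homology.** The cyclic group of order $n+1$, with generator $\lambda$, acts on $\overline{C}_n$. In degrees $0,1,2$ the action is $$\lambda(a)=a,\qquad \lambda\Big(\otimes\begin{pmatrix} a & \alpha\\ 1 & b\end{pmatrix}\Big)=-\otimes\begin{pmatrix} b & \alpha\\ 1 & a\end{pmatrix},\qquad \lambda\Big(\otimes\begin{pmatrix} a & \alpha & \beta\\ 1 & b & \gamma\\ 1 & 1 & c\end{pmatrix}\Big)=\otimes\begin{pmatrix} c & \beta & \gamma\\ 1 & a & \alpha\\ 1 & 1 & b\end{pmatrix}.$$ Set $\overline{C}_n^{\lambda}=\overline{C}_n/\mathrm{Im}(1-\lambda)$. The maps $\partial_n$ descend to these quotients, giving maps $\bar\partial_n:\overline{C}_n^\lambda\to\overline{C}_{n-1}^\lambda$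 that form a complex. Then $HC_1(A,B,\varepsilon)=\mathrm{Ker}(\bar\partial_1)/\mathrm{Im}(\bar\partial_2)$. **Secondary Kähler differentials.** $\Omega^1_{\mathcal{T}|\mathbb{k}}$ is the left $B\otimes A$-module generated by symbols $d(x)$, $x\in B\otimes A$, on which $B\otimes A$ acts through the algebra map $B\otimes A\to A$, $\alpha\otimes a\mapsto a\varepsilon(\alpha)$, i.e. $(\alpha\otimes a)\cdot d(\beta\otimes b)=a\varepsilon(\alpha)\,d(\beta\otimes b)$. So it is equivalently an $A$-module generated by these symbols. It is subject to the following relations, for all $a,b\in A$, $\alpha,\beta\in B$, $\lambda,\mu\in\mathbb{k}$: (i) $d(\lambda(\alpha\otimes a)+\mu(\beta\otimes b))=\lambda d(\alpha\otimes a)+\mu d(\beta\otimes b)$ (so $d$ is $\mathbb{k}$-linear on $B\otimes A$); (ii) $d(\alpha\beta\otimes ab)=a\varepsilon(\alpha)\,d(\beta\otimes b)+b\varepsilon(\beta)\,d(\alpha\otimes a)$; (iii) $d(\alpha\otimes 1)+d(\alpha\otimes 1)=d(1\otimes\varepsilon(\alpha))$. By (i), $d(1\otimes A)$ is a $\mathbb{k}$-linear subspace. *)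

theory Defs
  imports Complex_Main "HOL-Algebra.Module" "HOL-Algebra.AbelCoset"
begin

section \<open>Modules: homomorphisms, quotients, free modules, tensor products\<close>

text \<open>The record type of modules extends that of rings; for records that are only meant as modules
  the fields \<open>mult\<close> and \<open>one\<close> are irrelevant and are left \<open>undefined\<close>.\<close>

definition mod_hom ::
    "('r, 'q) ring_scheme \<Rightarrow> ('r, 'm, 's) module_scheme \<Rightarrow> ('r, 'n, 't) module_scheme \<Rightarrow> ('m \<Rightarrow> 'n) set"
  where "mod_hom R M N =
    {f \<in> carrier M \<rightarrow> carrier N.
      (\<forall>x \<in> carrier M. \<forall>y \<in> carrier M. f (x \<oplus>\<^bsub>M\<^esub> y) = f x \<oplus>\<^bsub>N\<^esub> f y) \<and>
      (\<forall>r \<in> carrier R. \<forall>x \<in> carrier M. f (r \<odot>\<^bsub>M\<^esub> x) = r \<odot>\<^bsub>N\<^esub> f x)}"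

definition mod_isomorphic ::
    "('r, 'q) ring_scheme \<Rightarrow> ('r, 'm, 's) module_scheme \<Rightarrow> ('r, 'n, 't) module_scheme \<Rightarrow> bool"
  where "mod_isomorphic R M N \<longleftrightarrow> (\<exists>f \<in> mod_hom R M N. bij_betw f (carrier M) (carrier N))"

definition generated_submodule ::
    "('r, 'q) ring_scheme \<Rightarrow> ('r, 'm, 's) module_scheme \<Rightarrow> 'm set \<Rightarrow> 'm set"
  where "generated_submodule R M S = \<Inter> {N. submodule N R M \<and> S \<subseteq> N}"

definition quot_module ::
    "('r, 'm, 's) module_scheme \<Rightarrow> 'm set \<Rightarrow> ('r, 'm set) module"
  where "quot_module M N =
    \<lparr>carrier = a_rcosets\<^bsub>M\<^esub> N, mult = undefined, one = undefined,
     zero = N, add = set_add M,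
     smult = (\<lambda>r X. \<Union>x \<in> X. N +>\<^bsub>M\<^esub> (r \<odot>\<^bsub>M\<^esub> x))\<rparr>"

text \<open>The map \<open>M/N \<rightarrow> M'/N'\<close> induced by \<open>f : M \<rightarrow> M'\<close> with \<open>f(N) \<subseteq> N'\<close>; on a coset \<open>N + x\<close>
  all members of the union agree.\<close>

definition induced_map ::
    "('r, 'n, 't) module_scheme \<Rightarrow> 'n set \<Rightarrow> ('m \<Rightarrow> 'n) \<Rightarrow> 'm set \<Rightarrow> 'n set"
  where "induced_map M' N' f X = (\<Union>x \<in> X. N' +>\<^bsub>M'\<^esub> f x)"

definition free_module :: "('r, 'q) ring_scheme \<Rightarrow> 'x set \<Rightarrow> ('r, 'x \<Rightarrow> 'r) module"
  where "free_module R X =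
    \<lparr>carrier = {f. (\<forall>x \<in> X. f x \<in> carrier R) \<and> (\<forall>x. x \<notin> X \<longrightarrow> f x = \<zero>\<^bsub>R\<^esub>)
                   \<and> finite {x. f x \<noteq> \<zero>\<^bsub>R\<^esub>}},
     mult = undefined, one = undefined,
     zero = (\<lambda>x. \<zero>\<^bsub>R\<^esub>), add = (\<lambda>f g x. f x \<oplus>\<^bsub>R\<^esub> g x),
     smult = (\<lambda>r f x. r \<otimes>\<^bsub>R\<^esub> f x)\<rparr>"

definition free_gen :: "('r, 'q) ring_scheme \<Rightarrow> 'x \<Rightarrow> 'x \<Rightarrow> 'r"
  where "free_gen R x = (\<lambda>y. if y = x then \<one>\<^bsub>R\<^esub> else \<zero>\<^bsub>R\<^esub>)"

definition tensor_free ::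
    "('k, 'q) ring_scheme \<Rightarrow> ('k, 'm, 's) module_scheme \<Rightarrow> ('k, 'n, 't) module_scheme
     \<Rightarrow> ('k, 'm \<times> 'n \<Rightarrow> 'k) module"
  where "tensor_free K M N = free_module K (carrier M \<times> carrier N)"

definition tensor_rels ::
    "('k, 'q) ring_scheme \<Rightarrow> ('k, 'm, 's) module_scheme \<Rightarrow> ('k, 'n, 't) module_scheme
     \<Rightarrow> ('m \<times> 'n \<Rightarrow> 'k) set"
  where "tensor_rels K M N = (let F = tensor_free K M N; g = free_gen K in
      {g (m \<oplus>\<^bsub>M\<^esub> m', n) \<ominus>\<^bsub>F\<^esub> (g (m, n) \<oplus>\<^bsub>F\<^esub> g (m', n)) | m m' n.
         m \<in> carrier M \<and> m' \<in> carrier M \<and> n \<in> carrier N}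
    \<union> {g (m, n \<oplus>\<^bsub>N\<^esub> n') \<ominus>\<^bsub>F\<^esub> (g (m, n) \<oplus>\<^bsub>F\<^esub> g (m, n')) | m n n'.
         m \<in> carrier M \<and> n \<in> carrier N \<and> n' \<in> carrier N}
    \<union> {g (r \<odot>\<^bsub>M\<^esub> m, n) \<ominus>\<^bsub>F\<^esub> (r \<odot>\<^bsub>F\<^esub> g (m, n)) | r m n.
         r \<in> carrier K \<and> m \<in> carrier M \<and> n \<in> carrier N}
    \<union> {g (m, r \<odot>\<^bsub>N\<^esub> n) \<ominus>\<^bsub>F\<^esub> (r \<odot>\<^bsub>F\<^esub> g (m, n)) | r m n.
         r \<in> carrier K \<and> m \<in> carrier M \<and> n \<in> carrier N})"

definition tensor ::
    "('k, 'q) ring_scheme \<Rightarrow> ('k, 'm, 's) module_scheme \<Rightarrow> ('k, 'n, 't) module_scheme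
     \<Rightarrow> ('k, ('m \<times> 'n \<Rightarrow> 'k) set) module"
  where "tensor K M N =
    quot_module (tensor_free K M N)
      (generated_submodule K (tensor_free K M N) (tensor_rels K M N))"

definition tens ::
    "('k, 'q) ring_scheme \<Rightarrow> ('k, 'm, 's) module_scheme \<Rightarrow> ('k, 'n, 't) module_scheme
     \<Rightarrow> 'm \<Rightarrow> 'n \<Rightarrow> ('m \<times> 'n \<Rightarrow> 'k) set"
  where "tens K M N m n =
    generated_submodule K (tensor_free K M N) (tensor_rels K M N)
      +>\<^bsub>tensor_free K M N\<^esub> free_gen K (m, n)"

section \<open>Base field and algebra morphisms\<close>

definition rat_ring :: "rat ring"
  where "rat_ring = \<lparr>carrier = UNIV, mult = (*), one = 1, zero = 0, add = (+)\<rparr>"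

definition contains_rationals :: "('k, 'q) ring_scheme \<Rightarrow> bool"
  where "contains_rationals K \<longleftrightarrow> (\<exists>\<iota> \<in> ring_hom rat_ring K. inj \<iota>)"

definition algebra_hom ::
    "('k, 'q) ring_scheme \<Rightarrow> ('k, 'b, 's) module_scheme \<Rightarrow> ('k, 'a, 't) module_scheme \<Rightarrow> ('b \<Rightarrow> 'a) set"
  where "algebra_hom K B A = ring_hom B A \<inter> mod_hom K B A"

section \<open>The secondary Hochschild complex in degrees at most 2\<close>

definition C0 :: "('k, 'q) ring_scheme \<Rightarrow> ('k, 'a) module \<Rightarrow> ('k, 'b) module \<Rightarrow> ('k, 'a) module"
  where "C0 K A B = A"

definition C1 where "C1 K A B = tensor K (tensor K A A) B"

definition C2 where
  "C2 K A B = tensor K (tensor K (tensor K A A) A) (tensor K (tensor K B B) B)"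

text \<open>Elementary tensors; the arguments are the upper triangular entries of the matrix, row by row.\<close>

definition mat2 where
  "mat2 K A B a \<alpha> b = tens K (tensor K A A) B (tens K A A a b) \<alpha>"

definition mat3 where
  "mat3 K A B a \<alpha> \<beta> b \<gamma> c =
     tens K (tensor K (tensor K A A) A) (tensor K (tensor K B B) B)
       (tens K (tensor K A A) A (tens K A A a b) c)
       (tens K (tensor K B B) B (tens K B B \<alpha> \<beta>) \<gamma>)"

text \<open>The \<open>K\<close>-linear maps determined by their values on elementary tensors; to make the description
  unique, they are required to be \<open>extensional\<close>, i.e. \<open>undefined\<close> outside of the carrier.\<close>

definition C1_linear_map where
  "C1_linear_map K A B P f =
     (THE h. h \<in> mod_hom K (C1 K A B) P \<and> h \<in> extensional (carrier (C1 K A B)) \<and>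
        (\<forall>a \<in> carrier A. \<forall>\<alpha> \<in> carrier B. \<forall>b \<in> carrier A. h (mat2 K A B a \<alpha> b) = f a \<alpha> b))"

definition C2_linear_map where
  "C2_linear_map K A B P f =
     (THE h. h \<in> mod_hom K (C2 K A B) P \<and> h \<in> extensional (carrier (C2 K A B)) \<and>
        (\<forall>a \<in> carrier A. \<forall>\<alpha> \<in> carrier B. \<forall>\<beta> \<in> carrier B.
         \<forall>b \<in> carrier A. \<forall>\<gamma> \<in> carrier B. \<forall>c \<in> carrier A.
           h (mat3 K A B a \<alpha> \<beta> b \<gamma> c) = f a \<alpha> \<beta> b \<gamma> c))"

definition bd1 where
  "bd1 K A B \<epsilon> = C1_linear_map K A B (C0 K A B)
     (\<lambda>a \<alpha> b. (a \<otimes>\<^bsub>A\<^esub> \<epsilon> \<alpha> \<otimes>\<^bsub>A\<^esub> b) \<ominus>\<^bsub>A\<^esub> (b \<otimes>\<^bsub>A\<^esub> \<epsilon> \<alpha> \<otimes>\<^bsub>A\<^esub> a))"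

definition bd2 where
  "bd2 K A B \<epsilon> = C2_linear_map K A B (C1 K A B)
     (\<lambda>a \<alpha> \<beta> b \<gamma> c.
        (mat2 K A B (a \<otimes>\<^bsub>A\<^esub> \<epsilon> \<alpha> \<otimes>\<^bsub>A\<^esub> b) (\<beta> \<otimes>\<^bsub>B\<^esub> \<gamma>) c
          \<ominus>\<^bsub>C1 K A B\<^esub> mat2 K A B a (\<alpha> \<otimes>\<^bsub>B\<^esub> \<beta>) (b \<otimes>\<^bsub>A\<^esub> \<epsilon> \<gamma> \<otimes>\<^bsub>A\<^esub> c))
          \<oplus>\<^bsub>C1 K A B\<^esub> mat2 K A B (c \<otimes>\<^bsub>A\<^esub> \<epsilon> \<beta> \<otimes>\<^bsub>A\<^esub> a) (\<alpha> \<otimes>\<^bsub>B\<^esub> \<gamma>) b)"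

section \<open>Secondary cyclic homology in degree 1\<close>

definition cyc0 :: "'a \<Rightarrow> 'a" where "cyc0 a = a"

definition cyc1 where
  "cyc1 K A B = C1_linear_map K A B (C1 K A B) (\<lambda>a \<alpha> b. \<ominus>\<^bsub>C1 K A B\<^esub> mat2 K A B b \<alpha> a)"

definition cyc2 where
  "cyc2 K A B = C2_linear_map K A B (C2 K A B) (\<lambda>a \<alpha> \<beta> b \<gamma> c. mat3 K A B c \<beta> \<gamma> a \<alpha> b)"

definition im_one_minus :: "('k, 'm, 's) module_scheme \<Rightarrow> ('m \<Rightarrow> 'm) \<Rightarrow> 'm set"
  where "im_one_minus M t = (\<lambda>x. x \<ominus>\<^bsub>M\<^esub> t x) ` carrier M"

definition C0cyc where
  "C0cyc K A B = quot_module (C0 K A B) (im_one_minus (C0 K A B) cyc0)"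

definition C1cyc where
  "C1cyc K A B = quot_module (C1 K A B) (im_one_minus (C1 K A B) (cyc1 K A B))"

definition C2cyc where
  "C2cyc K A B = quot_module (C2 K A B) (im_one_minus (C2 K A B) (cyc2 K A B))"

definition bd1cyc where
  "bd1cyc K A B \<epsilon> = induced_map (C0 K A B) (im_one_minus (C0 K A B) cyc0) (bd1 K A B \<epsilon>)"

definition bd2cyc where
  "bd2cyc K A B \<epsilon> = induced_map (C1 K A B) (im_one_minus (C1 K A B) (cyc1 K A B)) (bd2 K A B \<epsilon>)"

definition HC1 where
  "HC1 K A B \<epsilon> =
     quot_module
       ((C1cyc K A B)\<lparr>carrier := a_kernel (C1cyc K A B) (C0cyc K A B) (bd1cyc K A B \<epsilon>)\<rparr>)
       (bd2cyc K A B \<epsilon> ` carrier (C2cyc K A B))"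

section \<open>Secondary Kaehler differentials\<close>

text \<open>Since \<open>B \<otimes> A\<close> acts through the surjection \<open>B \<otimes> A \<rightarrow> A\<close>, the module is presented as an
  \<open>A\<close>-module, with one generator for each element (not just each elementary tensor) of \<open>B \<otimes> A\<close>.
  A scalar \<open>r\<close> of the base field acts as the element \<open>r \<cdot> 1\<close> of \<open>A\<close>.\<close>

definition kaehler_free where
  "kaehler_free K A B = free_module A (carrier (tensor K B A))"

definition kaehler_rels where
  "kaehler_rels K A B \<epsilon> =
    (let F = kaehler_free K A B; T = tensor K B A; g = free_gen A; t = tens K B A in
      {g (r \<odot>\<^bsub>T\<^esub> x \<oplus>\<^bsub>T\<^esub> s \<odot>\<^bsub>T\<^esub> y)
          \<ominus>\<^bsub>F\<^esub> ((r \<odot>\<^bsub>A\<^esub> \<one>\<^bsub>A\<^esub>) \<odot>\<^bsub>F\<^esub> g x \<oplus>\<^bsub>F\<^esub> (s \<odot>\<^bsub>A\<^esub> \<one>\<^bsub>A\<^esub>) \<odot>\<^bsub>F\<^esub> g y) | r s x y.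
         r \<in> carrier K \<and> s \<in> carrier K \<and> x \<in> carrier T \<and> y \<in> carrier T}
    \<union> {g (t (\<alpha> \<otimes>\<^bsub>B\<^esub> \<beta>) (a \<otimes>\<^bsub>A\<^esub> b))
          \<ominus>\<^bsub>F\<^esub> ((a \<otimes>\<^bsub>A\<^esub> \<epsilon> \<alpha>) \<odot>\<^bsub>F\<^esub> g (t \<beta> b) \<oplus>\<^bsub>F\<^esub> (b \<otimes>\<^bsub>A\<^esub> \<epsilon> \<beta>) \<odot>\<^bsub>F\<^esub> g (t \<alpha> a)) | \<alpha> \<beta> a b.
         \<alpha> \<in> carrier B \<and> \<beta> \<in> carrier B \<and> a \<in> carrier A \<and> b \<in> carrier A}
    \<union> {(g (t \<alpha> \<one>\<^bsub>A\<^esub>) \<oplus>\<^bsub>F\<^esub> g (t \<alpha> \<one>\<^bsub>A\<^esub>)) \<ominus>\<^bsub>F\<^esub> g (t \<one>\<^bsub>B\<^esub> (\<epsilon> \<alpha>)) | \<alpha>. \<alpha> \<in> carrier B})"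

definition Omega where
  "Omega K A B \<epsilon> =
     quot_module (kaehler_free K A B)
       (generated_submodule A (kaehler_free K A B) (kaehler_rels K A B \<epsilon>))"

definition kaehler_d where
  "kaehler_d K A B \<epsilon> x =
     generated_submodule A (kaehler_free K A B) (kaehler_rels K A B \<epsilon>)
       +>\<^bsub>kaehler_free K A B\<^esub> free_gen A x"

definition restrict_scalars ::
    "('k, 'a, 's) module_scheme \<Rightarrow> ('a, 'm, 't) module_scheme \<Rightarrow> ('k, 'm) module"
  where "restrict_scalars A M =
    \<lparr>carrier = carrier M, mult = mult M, one = one M, zero = zero M, add = add M,
     smult = (\<lambda>r x. (r \<odot>\<^bsub>A\<^esub> \<one>\<^bsub>A\<^esub>) \<odot>\<^bsub>M\<^esub> x)\<rparr>"

definition exact_differentials where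
  "exact_differentials K A B \<epsilon> =
     {kaehler_d K A B \<epsilon> (tens K B A \<one>\<^bsub>B\<^esub> a) | a. a \<in> carrier A}"

end

theory Submission
  imports Defs
begin

text \<open>
  By commutativity \<open>\<partial>\<^sub>1 = 0\<close>, so \<open>HC\<^sub>1\<close> is generated by the classes \<open>[a, \<alpha>, b]\<close> of elementary tensors,
  subject to multilinearity, \<open>[a, \<alpha>, b] = - [b, \<alpha>, a]\<close> and the relations \<open>\<partial>\<^sub>2 = 0\<close>. The isomorphism
  sends \<open>[a, \<alpha>, b]\<close> to the class of \<open>a d(\<alpha> \<otimes> b)\<close>.

  It is well defined because \<open>d(\<alpha> \<otimes> b) = \<epsilon>(\<alpha>) d(1 \<otimes> b) + b d(\<alpha> \<otimes> 1)\<close> and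
  \<open>2 d(\<alpha> \<otimes> 1) = d(1 \<otimes> \<epsilon>(\<alpha>))\<close>: the first relation is respected modulo exact forms, the second on the nose.
  Conversely, the relation \<open>\<partial>\<^sub>2 = 0\<close> with \<open>\<gamma> = 1\<close> is the Leibniz rule, with \<open>\<alpha> = \<beta> = 1\<close> and
  \<open>b = c = 1\<close> it is \<open>2 [a, \<gamma>, 1] = [a, 1, \<epsilon>(\<gamma>)]\<close>, and together with antisymmetry these give
  \<open>[1, 1, a] = 0\<close>, so the inverse is well defined too.
\<close>

section \<open>Linear maps and spanning sets\<close>

text \<open>All modules involved are iterated quotients of function spaces, so their elements are
  never handled directly: a map out of a quotient is built from its values on generators, and linear
  maps are compared on spanning sets. Each side thus gets a universal property
  (\<open>HC1_lift_exists\<close>, \<open>OmQ_lift_exists\<close>), and the isomorphism amounts to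
  matching two lists of relations.

  The obstacle is a mismatch of scalars. Differentials are presented over \<open>A\<close>, but d(1
  \<otimes> A) need not be an \<open>A\<close>-submodule, and \<open>HC1\<close> carries only a
  \<open>K\<close>-structure. Hence the differentials are restricted to \<open>K\<close>, the symbol
  c d(x) is treated as one expression that is \<open>K\<close>-linear in c and in x, and each
  relation of the presentation is carried along multiplied by an arbitrary coefficient c. Exactness
  alone is imposed only for c = 1.\<close>

lemma (in abelian_group) diff_eq_zero_iff:
  assumes "x \<in> carrier G" "y \<in> carrier G"
  shows "x \<ominus> y = \<zero> \<longleftrightarrow> x = y"
proof
  assume "x \<ominus> y = \<zero>"
  then have "x \<oplus> \<ominus> y = \<zero>" by (simp add: a_minus_def)
  then have "x = \<zero> \<oplus> \<ominus> (\<ominus> y)" using assms by (metis a_inv_closed minus_equality minus_minus l_zero)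
  then show "x = y" using assms by simp
qed (use assms in \<open>simp add: a_minus_def r_neg\<close>)

lemma mod_homI:
  assumes "\<And>x. x \<in> carrier M \<Longrightarrow> f x \<in> carrier N"
    and "\<And>x y. x \<in> carrier M \<Longrightarrow> y \<in> carrier M \<Longrightarrow> f (x \<oplus>\<^bsub>M\<^esub> y) = f x \<oplus>\<^bsub>N\<^esub> f y"
    and "\<And>r x. r \<in> carrier R \<Longrightarrow> x \<in> carrier M \<Longrightarrow> f (r \<odot>\<^bsub>M\<^esub> x) = r \<odot>\<^bsub>N\<^esub> f x"
  shows "f \<in> mod_hom R M N"
  using assms by (auto simp: mod_hom_def)

lemma mod_hom_closed: "f \<in> mod_hom R M N \<Longrightarrow> x \<in> carrier M \<Longrightarrow> f x \<in> carrier N"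
  and mod_hom_add: "f \<in> mod_hom R M N \<Longrightarrow> x \<in> carrier M \<Longrightarrow> y \<in> carrier M
    \<Longrightarrow> f (x \<oplus>\<^bsub>M\<^esub> y) = f x \<oplus>\<^bsub>N\<^esub> f y"
  and mod_hom_smult: "f \<in> mod_hom R M N \<Longrightarrow> r \<in> carrier R \<Longrightarrow> x \<in> carrier M
    \<Longrightarrow> f (r \<odot>\<^bsub>M\<^esub> x) = r \<odot>\<^bsub>N\<^esub> f x"
  by (auto simp: mod_hom_def)

lemma mod_hom_zero:
  assumes "module R M" "module R N" "f \<in> mod_hom R M N"
  shows "f \<zero>\<^bsub>M\<^esub> = \<zero>\<^bsub>N\<^esub>"
proof -
  interpret M: module R M by fact
  interpret N: module R N by fact
  have "f (\<zero>\<^bsub>R\<^esub> \<odot>\<^bsub>M\<^esub> \<zero>\<^bsub>M\<^esub>) = \<zero>\<^bsub>R\<^esub> \<odot>\<^bsub>N\<^esub> f \<zero>\<^bsub>M\<^esub>"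
    using assms(3) by (rule mod_hom_smult) auto
  then show ?thesis
    using mod_hom_closed[OF assms(3), of "\<zero>\<^bsub>M\<^esub>"] by simp
qed

lemma mod_hom_uminus:
  assumes "module R M" "module R N" "f \<in> mod_hom R M N" "x \<in> carrier M"
  shows "f (\<ominus>\<^bsub>M\<^esub> x) = \<ominus>\<^bsub>N\<^esub> f x"
proof -
  interpret M: module R M by fact
  interpret N: module R N by fact
  have "f (\<ominus>\<^bsub>M\<^esub> x) \<oplus>\<^bsub>N\<^esub> f x = f (\<ominus>\<^bsub>M\<^esub> x \<oplus>\<^bsub>M\<^esub> x)"
    using assms by (simp add: mod_hom_add)
  also have "\<dots> = \<zero>\<^bsub>N\<^esub>"
    using assms by (simp add: M.M.l_neg mod_hom_zero)
  finally show ?thesis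
    using assms by (intro N.M.minus_equality[symmetric]) (auto intro: mod_hom_closed)
qed

lemma mod_hom_minus:
  assumes "module R M" "module R N" "f \<in> mod_hom R M N" "x \<in> carrier M" "y \<in> carrier M"
  shows "f (x \<ominus>\<^bsub>M\<^esub> y) = f x \<ominus>\<^bsub>N\<^esub> f y"
proof -
  interpret M: module R M by fact
  show ?thesis
    using assms by (simp add: a_minus_def mod_hom_add mod_hom_uminus)
qed

lemma mod_hom_comp:
  assumes "f \<in> mod_hom R M N" "g \<in> mod_hom R N P"
  shows "(\<lambda>x. g (f x)) \<in> mod_hom R M P"
  using assms by (intro mod_homI) (auto simp: mod_hom_closed mod_hom_add mod_hom_smult)

lemma mod_hom_id: "(\<lambda>x. x) \<in> mod_hom R M M"
  by (rule mod_homI) auto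

text \<open>Values outside the carrier do not matter for \<open>mod_hom\<close>; this is what keeps
  the extensional restrictions behind \<open>C1_linear_map\<close> and \<open>C2_linear_map\<close>
  linear.\<close>

lemma mod_hom_cong:
  assumes "module R M" "f \<in> mod_hom R M N" "\<And>x. x \<in> carrier M \<Longrightarrow> g x = f x"
  shows "g \<in> mod_hom R M N"
proof -
  interpret M: module R M by fact
  show ?thesis
    using assms by (intro mod_homI) (auto simp: mod_hom_closed mod_hom_add mod_hom_smult)
qed

lemma mod_hom_plus:
  assumes "module R N" "f \<in> mod_hom R M N" "g \<in> mod_hom R M N"
  shows "(\<lambda>x. f x \<oplus>\<^bsub>N\<^esub> g x) \<in> mod_hom R M N"
proof -
  interpret N: module R N by fact
  show ?thesis
    using assms by (intro mod_homI)
      (auto simp: mod_hom_closed mod_hom_add mod_hom_smult N.M.a_ac N.smult_r_distr)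
qed

lemma mod_hom_scale:
  assumes "module R N" "f \<in> mod_hom R M N" "r \<in> carrier R"
  shows "(\<lambda>x. r \<odot>\<^bsub>N\<^esub> f x) \<in> mod_hom R M N"
proof -
  interpret N: module R N by fact
  show ?thesis
    using assms by (intro mod_homI)
      (auto simp: mod_hom_closed mod_hom_add mod_hom_smult N.smult_r_distr
        N.smult_assoc1[symmetric] N.R.m_comm)
qed

lemma mod_hom_neg:
  assumes "module R N" "f \<in> mod_hom R M N"
  shows "(\<lambda>x. \<ominus>\<^bsub>N\<^esub> f x) \<in> mod_hom R M N"
proof -
  interpret N: module R N by fact
  show ?thesis
    using assms by (intro mod_homI)
      (auto simp: mod_hom_closed mod_hom_add mod_hom_smult N.M.minus_add N.smult_r_minus)
qed

lemma mod_hom_diff: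
  assumes "module R N" "f \<in> mod_hom R M N" "g \<in> mod_hom R M N"
  shows "(\<lambda>x. f x \<ominus>\<^bsub>N\<^esub> g x) \<in> mod_hom R M N"
  unfolding a_minus_def by (rule mod_hom_plus[OF assms(1,2) mod_hom_neg[OF assms(1,3)]])

lemma submodule_vimage:
  assumes M: "module R M" and P: "module R P" and f: "f \<in> mod_hom R M P" and N: "submodule N R P"
  shows "submodule {x \<in> carrier M. f x \<in> N} R M"
proof -
  interpret M: module R M by fact
  interpret P: module R P by fact
  interpret N: submodule N R P by fact
  show ?thesis
    using N.one_closed P.submoduleE(3,4,5)[OF N]
    by (intro M.submoduleI)
      (auto simp: mod_hom_closed[OF f] mod_hom_add[OF f] mod_hom_smult[OF f]
        mod_hom_zero[OF M P f] mod_hom_uminus[OF M P f])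
qed

lemma submodule_image:
  assumes M: "module R M" and P: "module R P" and f: "f \<in> mod_hom R M P"
    and N: "submodule N R M"
  shows "submodule (f ` N) R P"
proof -
  interpret M: module R M by fact
  interpret P: module R P by fact
  interpret N: submodule N R M by fact
  note c = subsetD[OF M.submoduleE(1)[OF N]]
  show ?thesis
  proof (rule P.submoduleI)
    show "f ` N \<subseteq> carrier P" using c by (auto intro: mod_hom_closed[OF f])
    show "\<zero>\<^bsub>P\<^esub> \<in> f ` N"
      using N.one_closed by (force simp: mod_hom_zero[OF M P f, symmetric])
  next
    fix a assume "a \<in> f ` N"
    then show "\<ominus>\<^bsub>P\<^esub> a \<in> f ` N"
      using M.submoduleE(3)[OF N] by (auto simp: c mod_hom_uminus[OF M P f, symmetric])
  next
    fix a b assume "a \<in> f ` N" "b \<in> f ` N"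
    then show "a \<oplus>\<^bsub>P\<^esub> b \<in> f ` N"
      using M.submoduleE(5)[OF N] by (auto simp: c mod_hom_add[OF f, symmetric])
  next
    fix a b assume "a \<in> carrier R" "b \<in> f ` N"
    then show "a \<odot>\<^bsub>P\<^esub> b \<in> f ` N"
      using M.submoduleE(4)[OF N] by (auto simp: c mod_hom_smult[OF f, symmetric])
  qed
qed

lemma submodule_zero:
  assumes "module R M"
  shows "submodule {\<zero>\<^bsub>M\<^esub>} R M"
proof -
  interpret M: module R M by fact
  show ?thesis by (rule M.submoduleI) auto
qed

section \<open>Generated submodules and spanning sets\<close>

lemma generated_submodule_incl: "S \<subseteq> generated_submodule R M S"
  by (auto simp: generated_submodule_def)

lemma generated_submodule_least: "submodule N R M \<Longrightarrow> S \<subseteq> N \<Longrightarrow> generated_submodule R M S \<subseteq> N"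
  by (auto simp: generated_submodule_def)

lemma generated_submodule_submodule:
  assumes "module R M" "S \<subseteq> carrier M"
  shows "submodule (generated_submodule R M S) R M"
proof -
  interpret M: module R M by fact
  have c: "submodule (carrier M) R M" by (rule M.carrier_is_submodule)
  show ?thesis
  proof (rule M.submoduleI)
    show "generated_submodule R M S \<subseteq> carrier M"
      by (rule generated_submodule_least[OF c assms(2)])
    show "\<zero>\<^bsub>M\<^esub> \<in> generated_submodule R M S"
      using subgroup.one_closed[OF submodule.axioms(1)]
      by (fastforce simp: generated_submodule_def)
  qed (auto simp: generated_submodule_def M.submoduleE submodule.smult_closed)
qed

text \<open>Generation without linear combinations: no proper submodule contains S. An induction
  over generators then becomes the choice of a suitable submodule.\<close>

definition spans :: "('r, 'q) ring_scheme \<Rightarrow> ('r, 'm, 's) module_scheme \<Rightarrow> 'm set \<Rightarrow> bool"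
  where "spans R M S \<longleftrightarrow>
    S \<subseteq> carrier M \<and> (\<forall>N. submodule N R M \<longrightarrow> S \<subseteq> N \<longrightarrow> carrier M \<subseteq> N)"

lemma spans_image:
  assumes "module R M" "module R P" "spans R M S" "f \<in> mod_hom R M P" "f ` carrier M = carrier P"
  shows "spans R P (f ` S)"
  unfolding spans_def
proof (intro conjI allI impI)
  show "f ` S \<subseteq> carrier P" using assms by (auto simp: spans_def)
  fix N assume N: "submodule N R P" "f ` S \<subseteq> N"
  have "S \<subseteq> {x \<in> carrier M. f x \<in> N}" using assms(3) N(2) by (auto simp: spans_def)
  with submodule_vimage[OF assms(1,2,4) N(1)] assms(3)
  have "carrier M \<subseteq> {x \<in> carrier M. f x \<in> N}" by (simp add: spans_def)
  then have "f ` carrier M \<subseteq> N" by auto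
  then show "carrier P \<subseteq> N" by (simp only: assms(5))
qed

text \<open>The preimage of N under f is a submodule, hence everything as soon as it contains S.
  With f - g and the zero submodule this gives \<open>spans_hom_eq\<close>.\<close>

lemma spans_hom_into:
  assumes "module R M" "module R P" "spans R M S" "f \<in> mod_hom R M P" "submodule N R P"
    and "\<And>x. x \<in> S \<Longrightarrow> f x \<in> N" "x \<in> carrier M"
  shows "f x \<in> N"
proof -
  have "S \<subseteq> {x \<in> carrier M. f x \<in> N}" using assms(3,6) by (auto simp: spans_def)
  with submodule_vimage[OF assms(1,2,4,5)] assms(3)
  have "carrier M \<subseteq> {x \<in> carrier M. f x \<in> N}" by (simp add: spans_def)
  then show ?thesis using assms(7) by auto
qed

lemma spans_hom_eq:
  assumes M: "module R M" and P: "module R P" and S: "spans R M S"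
    and f: "f \<in> mod_hom R M P" and g: "g \<in> mod_hom R M P"
    and "\<And>x. x \<in> S \<Longrightarrow> f x = g x" and x: "x \<in> carrier M"
  shows "f x = g x"
proof -
  interpret P: module R P by fact
  have "f x \<ominus>\<^bsub>P\<^esub> g x \<in> {\<zero>\<^bsub>P\<^esub>}"
    using assms
    by (intro spans_hom_into[OF M P S mod_hom_diff[OF P f g] submodule_zero[OF P] _ x])
      (auto simp: spans_def mod_hom_closed P.M.r_neg a_minus_def subset_iff)
  then show ?thesis
    using x f g by (simp add: mod_hom_closed P.M.diff_eq_zero_iff)
qed

lemma spans_cong: "spans R M S \<Longrightarrow> S = T \<Longrightarrow> spans R M T"
  by simp

lemma spans_trans:
  assumes "spans R M S" "T \<subseteq> carrier M" "\<And>N. submodule N R M \<Longrightarrow> T \<subseteq> N \<Longrightarrow> S \<subseteq> N"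
  shows "spans R M T"
  using assms by (auto simp: spans_def)

text \<open>Both composites are linear and agree with the identity on a spanning set, so two maps
  that are inverse on generators are inverse everywhere.\<close>

lemma mod_isomorphicI:
  assumes M: "module R M" and N: "module R N" and S: "spans R M S" and T: "spans R N T"
    and f: "f \<in> mod_hom R M N" and g: "g \<in> mod_hom R N M"
    and gf: "\<And>x. x \<in> S \<Longrightarrow> g (f x) = x" and fg: "\<And>y. y \<in> T \<Longrightarrow> f (g y) = y"
  shows "mod_isomorphic R M N"
proof -
  have "g (f x) = x" if "x \<in> carrier M" for x
    using spans_hom_eq[OF M M S mod_hom_comp[OF f g] mod_hom_id gf that] by simp
  moreover have "f (g y) = y" if "y \<in> carrier N" for y
    using spans_hom_eq[OF N N T mod_hom_comp[OF g f] mod_hom_id fg that] by simp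
  ultimately have "bij_betw f (carrier M) (carrier N)"
    using mod_hom_closed[OF f] mod_hom_closed[OF g] by (intro bij_betwI[where g = g]) auto
  with f show ?thesis by (auto simp: mod_isomorphic_def)
qed

section \<open>Quotient modules\<close>

text \<open>A map that kills N is constant on each coset, so its image there is a singleton.
  Mentioning neither module nor submodule, the definition can be nested for iterated
  quotients.\<close>

definition quot_lift :: "('m \<Rightarrow> 'p) \<Rightarrow> 'm set \<Rightarrow> 'p"
  where "quot_lift f X = the_elem (f ` X)"

context
  fixes R :: "('r, 'q) ring_scheme" and M :: "('r, 'm, 's) module_scheme" and N :: "'m set"
  assumes M: "module R M" and N: "submodule N R M"
begin

interpretation M: module R M by (rule M)
interpretation N: submodule N R M by (rule N)
interpretation AS: abelian_subgroup N M
  by (rule abelian_subgroupI3[OF additive_subgroup.intro[OF N.subgroup_axioms]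
        M.M.abelian_group_axioms])

lemma quot_carrier: "carrier (quot_module M N) = (\<lambda>x. N +>\<^bsub>M\<^esub> x) ` carrier M"
  by (auto simp: quot_module_def A_RCOSETS_def' a_r_coset_def')

lemma quot_eq_iff:
  assumes "x \<in> carrier M" "y \<in> carrier M"
  shows "N +>\<^bsub>M\<^esub> x = N +>\<^bsub>M\<^esub> y \<longleftrightarrow> x \<ominus>\<^bsub>M\<^esub> y \<in> N"
proof
  assume "N +>\<^bsub>M\<^esub> x = N +>\<^bsub>M\<^esub> y"
  then have "x \<in> N +>\<^bsub>M\<^esub> y" using AS.a_rcos_self[OF assms(1)] by simp
  then show "x \<ominus>\<^bsub>M\<^esub> y \<in> N" using AS.a_rcos_module[OF assms(2,1)] by (simp add: a_minus_def)
next
  assume "x \<ominus>\<^bsub>M\<^esub> y \<in> N"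
  then have "x \<in> N +>\<^bsub>M\<^esub> y" using AS.a_rcos_module[OF assms(2,1)] by (simp add: a_minus_def)
  then show "N +>\<^bsub>M\<^esub> x = N +>\<^bsub>M\<^esub> y" using AS.a_repr_independence' assms(2) by simp
qed

lemma quot_zero_iff:
  assumes "x \<in> carrier M"
  shows "N +>\<^bsub>M\<^esub> x = \<zero>\<^bsub>quot_module M N\<^esub> \<longleftrightarrow> x \<in> N"
proof -
  have "x \<ominus>\<^bsub>M\<^esub> \<zero>\<^bsub>M\<^esub> = x"
    using assms M.M.minus_equality[of "\<zero>\<^bsub>M\<^esub>" "\<zero>\<^bsub>M\<^esub>"] by (simp add: a_minus_def)
  then show ?thesis
    using quot_eq_iff[OF assms M.M.zero_closed] by (simp add: quot_module_def AS.a_subset)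
qed

lemma quot_add:
  assumes "x \<in> carrier M" "y \<in> carrier M"
  shows "(N +>\<^bsub>M\<^esub> x) \<oplus>\<^bsub>quot_module M N\<^esub> (N +>\<^bsub>M\<^esub> y) = N +>\<^bsub>M\<^esub> (x \<oplus>\<^bsub>M\<^esub> y)"
  using assms by (simp add: quot_module_def AS.a_rcos_sum)

lemma quot_elem:
  assumes "x \<in> carrier M" "y \<in> N +>\<^bsub>M\<^esub> x"
  shows "y \<in> carrier M" "N +>\<^bsub>M\<^esub> y = N +>\<^bsub>M\<^esub> x"
  using AS.a_elemrcos_carrier[OF assms] AS.a_repr_independence'[OF assms(2,1)] by simp_all

text \<open>The product is a union over all representatives; they all yield the same coset, and
  since the coset is nonempty the union collapses to it.\<close>

lemma quot_smult:
  assumes "r \<in> carrier R" "x \<in> carrier M"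
  shows "r \<odot>\<^bsub>quot_module M N\<^esub> (N +>\<^bsub>M\<^esub> x) = N +>\<^bsub>M\<^esub> (r \<odot>\<^bsub>M\<^esub> x)"
proof -
  have "N +>\<^bsub>M\<^esub> (r \<odot>\<^bsub>M\<^esub> y) = N +>\<^bsub>M\<^esub> (r \<odot>\<^bsub>M\<^esub> x)" if y: "y \<in> N +>\<^bsub>M\<^esub> x" for y
  proof -
    have c: "y \<in> carrier M" and "y \<ominus>\<^bsub>M\<^esub> x \<in> N"
      using quot_elem[OF assms(2) y] quot_eq_iff assms by auto
    then have "r \<odot>\<^bsub>M\<^esub> (y \<ominus>\<^bsub>M\<^esub> x) \<in> N" using assms by simp
    with c show ?thesis
      using assms by (simp add: quot_eq_iff a_minus_def M.smult_r_distr M.smult_r_minus)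
  qed
  then have "(\<Union>y \<in> N +>\<^bsub>M\<^esub> x. N +>\<^bsub>M\<^esub> (r \<odot>\<^bsub>M\<^esub> y)) = (\<Union>y \<in> N +>\<^bsub>M\<^esub> x. N +>\<^bsub>M\<^esub> (r \<odot>\<^bsub>M\<^esub> x))"
    by (rule SUP_cong[OF refl])
  moreover have "N +>\<^bsub>M\<^esub> x \<noteq> {}" using AS.a_rcos_self[OF assms(2)] by blast
  ultimately show ?thesis by (simp add: quot_module_def)
qed

lemma quot_module_module: "module R (quot_module M N)"
proof (rule moduleI)
  show "cring R" ..
  have z: "\<zero>\<^bsub>quot_module M N\<^esub> = N +>\<^bsub>M\<^esub> \<zero>\<^bsub>M\<^esub>"
    by (simp add: quot_module_def AS.a_subset)
  show "abelian_group (quot_module M N)"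
  proof (rule abelian_groupI)
    fix x assume "x \<in> carrier (quot_module M N)"
    then obtain x' where x: "x' \<in> carrier M" "x = N +>\<^bsub>M\<^esub> x'" by (auto simp: quot_carrier)
    then have "(N +>\<^bsub>M\<^esub> \<ominus>\<^bsub>M\<^esub> x') \<oplus>\<^bsub>quot_module M N\<^esub> x = \<zero>\<^bsub>quot_module M N\<^esub>"
      by (simp add: quot_add z M.M.l_neg)
    then show "\<exists>y\<in>carrier (quot_module M N). y \<oplus>\<^bsub>quot_module M N\<^esub> x = \<zero>\<^bsub>quot_module M N\<^esub>"
      using x by (auto simp: quot_carrier)
  qed (auto simp: quot_carrier quot_add z M.M.a_ac)
qed (auto simp: quot_carrier quot_add quot_smult M.smult_r_distr M.smult_l_distr M.smult_assoc1)

lemma quot_proj_hom: "(\<lambda>x. N +>\<^bsub>M\<^esub> x) \<in> mod_hom R M (quot_module M N)"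
  by (rule mod_homI) (auto simp: quot_carrier quot_add quot_smult)

lemma quot_spans: "spans R M S \<Longrightarrow> spans R (quot_module M N) ((\<lambda>x. N +>\<^bsub>M\<^esub> x) ` S)"
  by (rule spans_image[OF M quot_module_module _ quot_proj_hom]) (auto simp: quot_carrier)

context
  fixes P :: "('r, 'p, 't) module_scheme" and f :: "'m \<Rightarrow> 'p"
  assumes P: "module R P" and f: "f \<in> mod_hom R M P" and fN: "\<And>x. x \<in> N \<Longrightarrow> f x = \<zero>\<^bsub>P\<^esub>"
begin

interpretation P: module R P by (rule P)

lemma quot_lift_coset:
  assumes "x \<in> carrier M"
  shows "quot_lift f (N +>\<^bsub>M\<^esub> x) = f x"
proof -
  have "f y = f x" if y: "y \<in> N +>\<^bsub>M\<^esub> x" for y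
  proof -
    have c: "y \<in> carrier M" and "y \<ominus>\<^bsub>M\<^esub> x \<in> N"
      using quot_elem[OF assms y] quot_eq_iff assms by auto
    then have "f y \<ominus>\<^bsub>P\<^esub> f x = \<zero>\<^bsub>P\<^esub>"
      using fN mod_hom_minus[OF M P f] assms by metis
    then show ?thesis
      using c assms by (simp add: mod_hom_closed[OF f] P.M.diff_eq_zero_iff)
  qed
  then have "f ` (N +>\<^bsub>M\<^esub> x) = {f x}"
    using AS.a_rcos_self[OF assms] by blast
  then show ?thesis by (simp add: quot_lift_def)
qed

lemma quot_lift_hom: "quot_lift f \<in> mod_hom R (quot_module M N) P"
  by (rule mod_homI)
    (auto simp: quot_carrier quot_add quot_smult quot_lift_coset
      mod_hom_closed[OF f] mod_hom_add[OF f] mod_hom_smult[OF f])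

end

lemma coset_self: "x \<in> carrier M \<Longrightarrow> x \<in> N +>\<^bsub>M\<^esub> x"
  by (rule AS.a_rcos_self)

end

lemma induced_map_coset:
  assumes M: "module R M" and N: "submodule N R M"
    and P: "module R P" and L: "submodule L R P" and f: "f \<in> mod_hom R M P"
    and fN: "\<And>x. x \<in> N \<Longrightarrow> f x \<in> L" and x: "x \<in> carrier M"
  shows "induced_map P L f (N +>\<^bsub>M\<^esub> x) = L +>\<^bsub>P\<^esub> f x"
proof -
  have "L +>\<^bsub>P\<^esub> f y = L +>\<^bsub>P\<^esub> f x" if y: "y \<in> N +>\<^bsub>M\<^esub> x" for y
  proof -
    have c: "y \<in> carrier M" and "y \<ominus>\<^bsub>M\<^esub> x \<in> N"
      using quot_elem[OF M N x y] quot_eq_iff[OF M N] x by auto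
    then have "f y \<ominus>\<^bsub>P\<^esub> f x \<in> L"
      using fN mod_hom_minus[OF M P f] x by metis
    then show ?thesis
      using c x quot_eq_iff[OF P L] by (simp add: mod_hom_closed[OF f])
  qed
  then have "(\<Union>y \<in> N +>\<^bsub>M\<^esub> x. L +>\<^bsub>P\<^esub> f y) = (\<Union>y \<in> N +>\<^bsub>M\<^esub> x. L +>\<^bsub>P\<^esub> f x)"
    by (rule SUP_cong[OF refl])
  moreover have "N +>\<^bsub>M\<^esub> x \<noteq> {}" using coset_self[OF M N x] by blast
  ultimately show ?thesis by (simp add: induced_map_def)
qed

section \<open>Free modules\<close>

lemma free_carrier_iff: "f \<in> carrier (free_module R X) \<longleftrightarrow>
    (\<forall>x \<in> X. f x \<in> carrier R) \<and> (\<forall>x. x \<notin> X \<longrightarrow> f x = \<zero>\<^bsub>R\<^esub>) \<and> finite {x. f x \<noteq> \<zero>\<^bsub>R\<^esub>}"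
  and free_zero: "\<zero>\<^bsub>free_module R X\<^esub> = (\<lambda>x. \<zero>\<^bsub>R\<^esub>)"
  and free_add: "f \<oplus>\<^bsub>free_module R X\<^esub> g = (\<lambda>x. f x \<oplus>\<^bsub>R\<^esub> g x)"
  and free_smult: "r \<odot>\<^bsub>free_module R X\<^esub> f = (\<lambda>x. r \<otimes>\<^bsub>R\<^esub> f x)"
  by (auto simp: free_module_def)

context
  fixes R :: "('r, 'q) ring_scheme"
  assumes R: "cring R"
begin

interpretation R: cring R by (rule R)

lemma free_val_closed: "f \<in> carrier (free_module R X) \<Longrightarrow> f x \<in> carrier R"
  by (cases "x \<in> X") (auto simp: free_carrier_iff)

lemma free_module_module: "module R (free_module R X)"
proof (rule moduleI)
  show "abelian_group (free_module R X)"
  proof (rule abelian_groupI)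
    fix f g assume fg: "f \<in> carrier (free_module R X)" "g \<in> carrier (free_module R X)"
    have "finite {x. f x \<oplus>\<^bsub>R\<^esub> g x \<noteq> \<zero>\<^bsub>R\<^esub>}"
      by (rule finite_subset[of _ "{x. f x \<noteq> \<zero>\<^bsub>R\<^esub>} \<union> {x. g x \<noteq> \<zero>\<^bsub>R\<^esub>}"])
        (use fg in \<open>auto simp: free_carrier_iff\<close>)
    then show "f \<oplus>\<^bsub>free_module R X\<^esub> g \<in> carrier (free_module R X)"
      using fg by (auto simp: free_carrier_iff free_add)
    show "f \<oplus>\<^bsub>free_module R X\<^esub> g = g \<oplus>\<^bsub>free_module R X\<^esub> f"
      using fg by (auto simp: free_add free_val_closed R.a_comm)
    fix h assume h: "h \<in> carrier (free_module R X)"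
    show "f \<oplus>\<^bsub>free_module R X\<^esub> g \<oplus>\<^bsub>free_module R X\<^esub> h = f \<oplus>\<^bsub>free_module R X\<^esub> (g \<oplus>\<^bsub>free_module R X\<^esub> h)"
      using fg free_val_closed[OF h] by (auto simp: free_add free_val_closed R.a_assoc)
  next
    fix f assume f: "f \<in> carrier (free_module R X)"
    show "\<zero>\<^bsub>free_module R X\<^esub> \<oplus>\<^bsub>free_module R X\<^esub> f = f"
      using f by (auto simp: free_add free_zero free_val_closed)
    have "finite {x. \<ominus>\<^bsub>R\<^esub> f x \<noteq> \<zero>\<^bsub>R\<^esub>}"
      by (rule finite_subset[of _ "{x. f x \<noteq> \<zero>\<^bsub>R\<^esub>}"]) (use f in \<open>auto simp: free_carrier_iff\<close>)
    then have "(\<lambda>x. \<ominus>\<^bsub>R\<^esub> f x) \<in> carrier (free_module R X)"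
      using f by (auto simp: free_carrier_iff)
    then show "\<exists>g \<in> carrier (free_module R X). g \<oplus>\<^bsub>free_module R X\<^esub> f = \<zero>\<^bsub>free_module R X\<^esub>"
      using f by (intro bexI) (auto simp: free_add free_zero free_val_closed R.l_neg)
  qed (auto simp: free_carrier_iff free_zero)
next
  fix r f assume r: "r \<in> carrier R" and f: "f \<in> carrier (free_module R X)"
  have "finite {x. r \<otimes>\<^bsub>R\<^esub> f x \<noteq> \<zero>\<^bsub>R\<^esub>}"
    by (rule finite_subset[of _ "{x. f x \<noteq> \<zero>\<^bsub>R\<^esub>}"]) (use r f in \<open>auto simp: free_carrier_iff\<close>)
  then show "r \<odot>\<^bsub>free_module R X\<^esub> f \<in> carrier (free_module R X)"
    using r f by (auto simp: free_carrier_iff free_smult)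
qed (auto simp: free_smult free_add free_val_closed R.l_distr R.r_distr R.m_assoc R.is_cring)

lemma free_gen_closed: "x \<in> X \<Longrightarrow> free_gen R x \<in> carrier (free_module R X)"
  by (auto simp: free_carrier_iff free_gen_def)

text \<open>Induction on the size of the support: setting one nonzero coefficient to zero splits off
  a multiple of a generator and shrinks the support by one.\<close>

lemma free_module_induct [consumes 1, case_names zero gen add]:
  assumes "f \<in> carrier (free_module R X)"
    and zero: "Q \<zero>\<^bsub>free_module R X\<^esub>"
    and gen: "\<And>r x. r \<in> carrier R \<Longrightarrow> x \<in> X \<Longrightarrow> Q (r \<odot>\<^bsub>free_module R X\<^esub> free_gen R x)"
    and add: "\<And>f g. f \<in> carrier (free_module R X) \<Longrightarrow> g \<in> carrier (free_module R X) \<Longrightarrow>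
      Q f \<Longrightarrow> Q g \<Longrightarrow> Q (f \<oplus>\<^bsub>free_module R X\<^esub> g)"
  shows "Q f"
  using assms(1)
proof (induction "card {x. f x \<noteq> \<zero>\<^bsub>R\<^esub>}" arbitrary: f)
  case 0
  then have "f = \<zero>\<^bsub>free_module R X\<^esub>" by (auto simp: free_carrier_iff free_zero)
  with zero show ?case by simp
next
  case (Suc n)
  interpret F: module R "free_module R X" by (rule free_module_module)
  from Suc(2) have "{x. f x \<noteq> \<zero>\<^bsub>R\<^esub>} \<noteq> {}" by (metis card.empty nat.distinct(1))
  then obtain x where x: "f x \<noteq> \<zero>\<^bsub>R\<^esub>" by auto
  have xX: "x \<in> X" using x Suc(3) by (auto simp: free_carrier_iff)
  define g where "g = f(x := \<zero>\<^bsub>R\<^esub>)"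
  have supp: "{y. g y \<noteq> \<zero>\<^bsub>R\<^esub>} = {y. f y \<noteq> \<zero>\<^bsub>R\<^esub>} - {x}" by (auto simp: g_def)
  have fin: "finite {y. f y \<noteq> \<zero>\<^bsub>R\<^esub>}" using Suc(3) by (auto simp: free_carrier_iff)
  have g: "g \<in> carrier (free_module R X)"
    using Suc(3) fin supp by (auto simp: free_carrier_iff g_def)
  have Qg: "Q g" using Suc(1)[OF _ g] Suc(2) supp fin x by simp
  have eq: "f = g \<oplus>\<^bsub>free_module R X\<^esub> (f x \<odot>\<^bsub>free_module R X\<^esub> free_gen R x)"
    using Suc(3) by (auto simp: free_add free_smult free_gen_def g_def free_val_closed)
  show ?case
    by (subst eq, intro add[OF g _ Qg gen] F.smult_closed free_val_closed[OF Suc(3)]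
        free_gen_closed xX)
qed

lemma free_module_spans: "spans R (free_module R X) (free_gen R ` X)"
  unfolding spans_def
proof (intro conjI allI impI subsetI)
  interpret F: module R "free_module R X" by (rule free_module_module)
  fix N f assume N: "submodule N R (free_module R X)" "free_gen R ` X \<subseteq> N"
    and "f \<in> carrier (free_module R X)"
  from this(3) show "f \<in> N"
    by (induction rule: free_module_induct)
      (use N F.submoduleE(4,5)[OF N(1)] subgroup.one_closed[OF submodule.axioms(1)[OF N(1)]] in auto)
qed (auto intro: free_gen_closed)

end

text \<open>The summand \<open>h x r\<close> is only required to be additive in the coefficient r,
  instead of being r times a vector. This covers both uses: \<open>K\<close>-linear maps for tensor
  products, where \<open>h\<close> is a scalar multiple, and maps from a free
  \<open>A\<close>-module into a mere \<open>K\<close>-module, where the target has no action of the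
  coefficients.\<close>

definition free_lift ::
    "('r, 'q) ring_scheme \<Rightarrow> ('p, 's) ring_scheme \<Rightarrow> ('x \<Rightarrow> 'r \<Rightarrow> 'p) \<Rightarrow> ('x \<Rightarrow> 'r) \<Rightarrow> 'p"
  where "free_lift R P h f = (\<Oplus>\<^bsub>P\<^esub>x \<in> {x. f x \<noteq> \<zero>\<^bsub>R\<^esub>}. h x (f x))"

context
  fixes R :: "('r, 'q) ring_scheme" and P :: "('p, 's) ring_scheme" and X :: "'x set"
    and h :: "'x \<Rightarrow> 'r \<Rightarrow> 'p"
  assumes R: "cring R" and P: "abelian_group P"
    and h_closed: "\<And>x r. x \<in> X \<Longrightarrow> r \<in> carrier R \<Longrightarrow> h x r \<in> carrier P"
    and h_add: "\<And>x r s. x \<in> X \<Longrightarrow> r \<in> carrier R \<Longrightarrow> s \<in> carrier R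
      \<Longrightarrow> h x (r \<oplus>\<^bsub>R\<^esub> s) = h x r \<oplus>\<^bsub>P\<^esub> h x s"
begin

interpretation R: cring R by (rule R)
interpretation P: abelian_group P by (rule P)

lemma free_lift_zero_coeff: "x \<in> X \<Longrightarrow> h x \<zero>\<^bsub>R\<^esub> = \<zero>\<^bsub>P\<^esub>"
  using h_add[of x "\<zero>\<^bsub>R\<^esub>" "\<zero>\<^bsub>R\<^esub>"] h_closed[of x "\<zero>\<^bsub>R\<^esub>"] by (simp add: P.add.l_cancel_one)

lemma free_lift_superset:
  assumes "f \<in> carrier (free_module R X)" "finite U" "U \<subseteq> X" "{x. f x \<noteq> \<zero>\<^bsub>R\<^esub>} \<subseteq> U"
  shows "free_lift R P h f = (\<Oplus>\<^bsub>P\<^esub>x \<in> U. h x (f x))"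
  unfolding free_lift_def
  by (rule P.add.finprod_mono_neutral_cong_left)
    (use assms in \<open>auto simp: free_lift_zero_coeff h_closed free_carrier_iff\<close>)

lemma free_lift_closed: "f \<in> carrier (free_module R X) \<Longrightarrow> free_lift R P h f \<in> carrier P"
  unfolding free_lift_def by (rule P.finsum_closed) (auto simp: free_carrier_iff intro!: h_closed)

lemma free_lift_add:
  assumes f: "f \<in> carrier (free_module R X)" and g: "g \<in> carrier (free_module R X)"
  shows "free_lift R P h (f \<oplus>\<^bsub>free_module R X\<^esub> g) = free_lift R P h f \<oplus>\<^bsub>P\<^esub> free_lift R P h g"
proof -
  interpret F: module R "free_module R X" by (rule free_module_module[OF R])
  \<comment> \<open>The support of the sum may be smaller than this union because coefficients can
    cancel, so all three sums are taken over the union.\<close>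
  let ?U = "{x. f x \<noteq> \<zero>\<^bsub>R\<^esub>} \<union> {x. g x \<noteq> \<zero>\<^bsub>R\<^esub>}"
  have U: "finite ?U" "?U \<subseteq> X" using f g by (auto simp: free_carrier_iff)
  have "{x. (f \<oplus>\<^bsub>free_module R X\<^esub> g) x \<noteq> \<zero>\<^bsub>R\<^esub>} \<subseteq> ?U" by (auto simp: free_add)
  then have "free_lift R P h (f \<oplus>\<^bsub>free_module R X\<^esub> g)
      = (\<Oplus>\<^bsub>P\<^esub>x \<in> ?U. h x ((f \<oplus>\<^bsub>free_module R X\<^esub> g) x))"
    using f g by (intro free_lift_superset[OF _ U]) auto
  also have "\<dots> = (\<Oplus>\<^bsub>P\<^esub>x \<in> ?U. h x (f x) \<oplus>\<^bsub>P\<^esub> h x (g x))"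
    using U f g by (intro P.finsum_cong')
      (auto simp: free_add free_val_closed[OF R] h_add h_closed subset_iff)
  also have "\<dots> = (\<Oplus>\<^bsub>P\<^esub>x \<in> ?U. h x (f x)) \<oplus>\<^bsub>P\<^esub> (\<Oplus>\<^bsub>P\<^esub>x \<in> ?U. h x (g x))"
    using U f g by (intro P.finsum_addf) (auto simp: free_val_closed[OF R] h_closed subset_iff)
  also have "\<dots> = free_lift R P h f \<oplus>\<^bsub>P\<^esub> free_lift R P h g"
    using free_lift_superset[OF f U] free_lift_superset[OF g U] by simp
  finally show ?thesis .
qed

lemma free_lift_gen:
  assumes "r \<in> carrier R" "x \<in> X"
  shows "free_lift R P h (r \<odot>\<^bsub>free_module R X\<^esub> free_gen R x) = h x r"
proof -
  interpret F: module R "free_module R X" by (rule free_module_module[OF R])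
  have "free_lift R P h (r \<odot>\<^bsub>free_module R X\<^esub> free_gen R x)
      = (\<Oplus>\<^bsub>P\<^esub>y \<in> {x}. h y ((r \<odot>\<^bsub>free_module R X\<^esub> free_gen R x) y))"
    using assms by (intro free_lift_superset)
      (auto simp: free_gen_closed[OF R], auto simp: free_smult free_gen_def split: if_splits)
  also have "\<dots> = h x r"
    using assms by (simp add: free_smult free_gen_def h_closed)
  finally show ?thesis .
qed

end

section \<open>Tensor products\<close>

definition bilin where
  "bilin K M N P f \<longleftrightarrow> (\<forall>n \<in> carrier N. (\<lambda>m. f m n) \<in> mod_hom K M P)
    \<and> (\<forall>m \<in> carrier M. (\<lambda>n. f m n) \<in> mod_hom K N P)"

definition tensor_lift where
  "tensor_lift K P f = quot_lift (free_lift K P (\<lambda>(m, n) r. r \<odot>\<^bsub>P\<^esub> f m n))"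


context
  fixes K :: "('k, 'q) ring_scheme" and M :: "('k, 'm, 's) module_scheme"
    and N :: "('k, 'n, 't) module_scheme"
  assumes M: "module K M" and N: "module K N"
begin

interpretation M: module K M by (rule M)
interpretation N: module K N by (rule N)

private abbreviation (input) "FF \<equiv> tensor_free K M N"
private abbreviation (input) "RR \<equiv> generated_submodule K FF (tensor_rels K M N)"

lemma tensor_free_module: "module K FF"
  unfolding tensor_free_def by (rule free_module_module) (rule M.R.is_cring)

interpretation F: module K FF by (rule tensor_free_module)

lemma tensor_gen_closed:
  "m \<in> carrier M \<Longrightarrow> n \<in> carrier N \<Longrightarrow> free_gen K (m, n) \<in> carrier FF"
  unfolding tensor_free_def by (rule free_gen_closed[OF M.R.is_cring]) auto

lemma tensor_rels_submodule: "submodule RR K FF"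
  by (rule generated_submodule_submodule[OF tensor_free_module])
    (auto simp: tensor_rels_def Let_def intro!: F.M.minus_closed F.M.a_closed F.smult_closed tensor_gen_closed)

lemma tensor_module: "module K (tensor K M N)"
  unfolding tensor_def by (rule quot_module_module[OF tensor_free_module tensor_rels_submodule])

lemma tens_closed: "m \<in> carrier M \<Longrightarrow> n \<in> carrier N \<Longrightarrow> tens K M N m n \<in> carrier (tensor K M N)"
  unfolding tens_def tensor_def
  by (simp add: quot_carrier[OF tensor_free_module tensor_rels_submodule] tensor_gen_closed)

lemma tensor_spans: "spans K (tensor K M N) {tens K M N m n | m n. m \<in> carrier M \<and> n \<in> carrier N}"
proof -
  have "spans K FF (free_gen K ` (carrier M \<times> carrier N))"
    unfolding tensor_free_def by (rule free_module_spans) (rule M.R.is_cring)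
  from quot_spans[OF tensor_free_module tensor_rels_submodule this] show ?thesis
    unfolding tensor_def[symmetric] by (rule spans_cong) (auto simp: tens_def)
qed

text \<open>Each law is one of the defining relations: the difference of the two representatives is
  a generator of the submodule divided out.\<close>

lemma tens_bilin: "bilin K M N (tensor K M N) (tens K M N)"
  unfolding bilin_def
proof (intro conjI ballI mod_homI)
  note eqI = quot_eq_iff[OF tensor_free_module tensor_rels_submodule, THEN iffD2, rotated -1]
  note rel = subsetD[OF generated_submodule_incl[of "tensor_rels K M N" K FF]]
  note qs = quot_add[OF tensor_free_module tensor_rels_submodule]
    quot_smult[OF tensor_free_module tensor_rels_submodule]
  {
    fix m m' n assume "m \<in> carrier M" "m' \<in> carrier M" "n \<in> carrier N"
    then show "tens K M N (m \<oplus>\<^bsub>M\<^esub> m') n = tens K M N m n \<oplus>\<^bsub>tensor K M N\<^esub> tens K M N m' n"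
      unfolding tens_def tensor_def
      by (subst qs; (intro tensor_gen_closed eqI rel F.M.a_closed)?)
        (auto simp: tensor_rels_def Let_def)
  next
    fix m n n' assume "m \<in> carrier M" "n \<in> carrier N" "n' \<in> carrier N"
    then show "tens K M N m (n \<oplus>\<^bsub>N\<^esub> n') = tens K M N m n \<oplus>\<^bsub>tensor K M N\<^esub> tens K M N m n'"
      unfolding tens_def tensor_def
      by (subst qs; (intro tensor_gen_closed eqI rel F.M.a_closed)?)
        (auto simp: tensor_rels_def Let_def)
  next
    fix r m n assume "r \<in> carrier K" "m \<in> carrier M" "n \<in> carrier N"
    then show "tens K M N (r \<odot>\<^bsub>M\<^esub> m) n = r \<odot>\<^bsub>tensor K M N\<^esub> tens K M N m n"
      and "tens K M N m (r \<odot>\<^bsub>N\<^esub> n) = r \<odot>\<^bsub>tensor K M N\<^esub> tens K M N m n"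
      unfolding tens_def tensor_def
      by (subst qs; (intro tensor_gen_closed eqI rel F.smult_closed)?;
        auto simp: tensor_rels_def Let_def)+
  }
qed (auto intro: tens_closed)

context
  fixes P :: "('k, 'p, 'u) module_scheme" and f :: "'m \<Rightarrow> 'n \<Rightarrow> 'p"
  assumes P: "module K P" and f: "bilin K M N P f"
begin

interpretation P: module K P by (rule P)

lemma bilinD:
  "m \<in> carrier M \<Longrightarrow> n \<in> carrier N \<Longrightarrow> f m n \<in> carrier P"
  "m \<in> carrier M \<Longrightarrow> m' \<in> carrier M \<Longrightarrow> n \<in> carrier N \<Longrightarrow> f (m \<oplus>\<^bsub>M\<^esub> m') n = f m n \<oplus>\<^bsub>P\<^esub> f m' n"
  "m \<in> carrier M \<Longrightarrow> n \<in> carrier N \<Longrightarrow> n' \<in> carrier N \<Longrightarrow> f m (n \<oplus>\<^bsub>N\<^esub> n') = f m n \<oplus>\<^bsub>P\<^esub> f m n'"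
  "r \<in> carrier K \<Longrightarrow> m \<in> carrier M \<Longrightarrow> n \<in> carrier N \<Longrightarrow> f (r \<odot>\<^bsub>M\<^esub> m) n = r \<odot>\<^bsub>P\<^esub> f m n"
  "r \<in> carrier K \<Longrightarrow> m \<in> carrier M \<Longrightarrow> n \<in> carrier N \<Longrightarrow> f m (r \<odot>\<^bsub>N\<^esub> n) = r \<odot>\<^bsub>P\<^esub> f m n"
  using f by (auto simp: bilin_def mod_hom_def)

private abbreviation (input) "LL \<equiv> free_lift K P (\<lambda>(m, n) r. r \<odot>\<^bsub>P\<^esub> f m n)"

lemma tensor_free_lift_gen':
  "r \<in> carrier K \<Longrightarrow> m \<in> carrier M \<Longrightarrow> n \<in> carrier N \<Longrightarrow> LL (r \<odot>\<^bsub>FF\<^esub> free_gen K (m, n)) = r \<odot>\<^bsub>P\<^esub> f m n"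
  unfolding tensor_free_def
  by (subst free_lift_gen[OF M.R.is_cring P.M.abelian_group_axioms])
    (auto simp: bilinD P.smult_l_distr)

lemma tensor_free_lift_gen:
  "m \<in> carrier M \<Longrightarrow> n \<in> carrier N \<Longrightarrow> LL (free_gen K (m, n)) = f m n"
  using tensor_free_lift_gen'[of "\<one>\<^bsub>K\<^esub>" m n] by (simp add: tensor_gen_closed bilinD)

lemma tensor_free_lift_hom: "LL \<in> mod_hom K FF P"
proof -
  have cl: "LL g \<in> carrier P" if "g \<in> carrier FF" for g
    using that unfolding tensor_free_def
    by (rule free_lift_closed[OF M.R.is_cring P.M.abelian_group_axioms, rotated -1])
      (auto simp: bilinD P.smult_l_distr)
  have ad: "LL (g \<oplus>\<^bsub>FF\<^esub> g') = LL g \<oplus>\<^bsub>P\<^esub> LL g'" if "g \<in> carrier FF" "g' \<in> carrier FF" for g g'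
    using that unfolding tensor_free_def
    by (rule free_lift_add[OF M.R.is_cring P.M.abelian_group_axioms, rotated -2])
      (auto simp: bilinD P.smult_l_distr)
  have z: "LL \<zero>\<^bsub>FF\<^esub> = \<zero>\<^bsub>P\<^esub>"
    using ad[of "\<zero>\<^bsub>FF\<^esub>" "\<zero>\<^bsub>FF\<^esub>"] cl[of "\<zero>\<^bsub>FF\<^esub>"] by (simp add: P.M.add.l_cancel_one)
  \<comment> \<open>\<open>free_lift\<close> knows only additivity in the coefficients;
    compatibility with scalars is recovered by induction from the multiples of generators.\<close>
  have "LL (r \<odot>\<^bsub>FF\<^esub> g) = r \<odot>\<^bsub>P\<^esub> LL g" if r: "r \<in> carrier K" and g: "g \<in> carrier FF" for r g
  proof (rule free_module_induct[OF M.R.is_cring g[unfolded tensor_free_def],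
        where Q = "\<lambda>g. LL (r \<odot>\<^bsub>FF\<^esub> g) = r \<odot>\<^bsub>P\<^esub> LL g"])
    show "LL (r \<odot>\<^bsub>FF\<^esub> \<zero>\<^bsub>free_module K (carrier M \<times> carrier N)\<^esub>)
        = r \<odot>\<^bsub>P\<^esub> LL \<zero>\<^bsub>free_module K (carrier M \<times> carrier N)\<^esub>"
      using r z by (simp flip: tensor_free_def)
  next
    fix s x assume "s \<in> carrier K" "x \<in> carrier M \<times> carrier N"
    then show "LL (r \<odot>\<^bsub>FF\<^esub> (s \<odot>\<^bsub>free_module K (carrier M \<times> carrier N)\<^esub> free_gen K x))
        = r \<odot>\<^bsub>P\<^esub> LL (s \<odot>\<^bsub>free_module K (carrier M \<times> carrier N)\<^esub> free_gen K x)"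
      using r tensor_free_lift_gen' tensor_gen_closed
      by (auto simp flip: tensor_free_def simp: F.smult_assoc1[symmetric] P.smult_assoc1 bilinD)
  next
    fix g g' assume "g \<in> carrier (free_module K (carrier M \<times> carrier N))"
      "g' \<in> carrier (free_module K (carrier M \<times> carrier N))"
      "LL (r \<odot>\<^bsub>FF\<^esub> g) = r \<odot>\<^bsub>P\<^esub> LL g" "LL (r \<odot>\<^bsub>FF\<^esub> g') = r \<odot>\<^bsub>P\<^esub> LL g'"
    then show "LL (r \<odot>\<^bsub>FF\<^esub> (g \<oplus>\<^bsub>free_module K (carrier M \<times> carrier N)\<^esub> g'))
        = r \<odot>\<^bsub>P\<^esub> LL (g \<oplus>\<^bsub>free_module K (carrier M \<times> carrier N)\<^esub> g')"
      using r by (simp flip: tensor_free_def add: F.smult_r_distr ad cl P.smult_r_distr)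
  qed
  with cl ad show ?thesis by (intro mod_homI)
qed

lemma tensor_free_lift_rels:
  assumes "x \<in> RR"
  shows "LL x = \<zero>\<^bsub>P\<^esub>"
proof -
  have "tensor_rels K M N \<subseteq> {x \<in> carrier FF. LL x \<in> {\<zero>\<^bsub>P\<^esub>}}"
    unfolding tensor_rels_def Let_def
    by (auto simp: mod_hom_minus[OF tensor_free_module P tensor_free_lift_hom]
        mod_hom_add[OF tensor_free_lift_hom] mod_hom_smult[OF tensor_free_lift_hom]
        tensor_gen_closed tensor_free_lift_gen bilinD P.M.diff_eq_zero_iff)
  from generated_submodule_least[OF submodule_vimage[OF tensor_free_module P tensor_free_lift_hom
      submodule_zero[OF P]] this]
  show ?thesis using assms by auto
qed

lemma tensor_lift_hom: "tensor_lift K P f \<in> mod_hom K (tensor K M N) P"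
  unfolding tensor_lift_def tensor_def
  by (rule quot_lift_hom[OF tensor_free_module tensor_rels_submodule P tensor_free_lift_hom
        tensor_free_lift_rels])

lemma tensor_lift_tens:
  assumes "m \<in> carrier M" "n \<in> carrier N"
  shows "tensor_lift K P f (tens K M N m n) = f m n"
  unfolding tensor_lift_def tens_def
  by (subst quot_lift_coset[OF tensor_free_module tensor_rels_submodule P tensor_free_lift_hom
        tensor_free_lift_rels])
    (use assms in \<open>auto simp: tensor_gen_closed tensor_free_lift_gen\<close>)

end

end

text \<open>Linearity is used one factor at a time: first m leaves S while n stays in T, then n
  leaves T while m is already arbitrary.\<close>

lemma tensor_spans_tens:
  assumes M: "module K M" and N: "module K N" and S: "spans K M S" and T: "spans K N T"
  shows "spans K (tensor K M N) {tens K M N m n | m n. m \<in> S \<and> n \<in> T}"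
proof (rule spans_trans[OF tensor_spans[OF M N]])
  show "{tens K M N m n | m n. m \<in> S \<and> n \<in> T} \<subseteq> carrier (tensor K M N)"
    using S T by (auto simp: spans_def intro!: tens_closed[OF M N])
  fix L assume L: "submodule L K (tensor K M N)" and sub: "{tens K M N m n | m n. m \<in> S \<and> n \<in> T} \<subseteq> L"
  have hom: "(\<lambda>m. tens K M N m n) \<in> mod_hom K M (tensor K M N)" if "n \<in> carrier N" for n
    using tens_bilin[OF M N] that by (simp add: bilin_def)
  have hom': "tens K M N m \<in> mod_hom K N (tensor K M N)" if "m \<in> carrier M" for m
    using tens_bilin[OF M N] that by (simp add: bilin_def)
  have *: "tens K M N m n \<in> L" if "m \<in> carrier M" "n \<in> T" for m n
    by (rule spans_hom_into[OF M tensor_module[OF M N] S hom L]) (use that T sub in \<open>auto simp: spans_def\<close>)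
  have "tens K M N m n \<in> L" if "m \<in> carrier M" "n \<in> carrier N" for m n
    by (rule spans_hom_into[OF N tensor_module[OF M N] T hom' L]) (use that * in auto)
  then show "{tens K M N m n | m n. m \<in> carrier M \<and> n \<in> carrier N} \<subseteq> L" by auto
qed

text \<open>If a family of bilinear maps depends linearly on a parameter, so does its lift at a
  fixed tensor, because both sides of each law are linear in the tensor and agree on elementary
  ones. This is what allows lifts to be iterated.\<close>

lemma tensor_lift_param:
  assumes M: "module K M" and N: "module K N" and P: "module K P" and Q: "module K Q"
    and f: "\<And>q. q \<in> carrier Q \<Longrightarrow> bilin K M N P (f q)"
    and fq: "\<And>m n. m \<in> carrier M \<Longrightarrow> n \<in> carrier N \<Longrightarrow> (\<lambda>q. f q m n) \<in> mod_hom K Q P"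
    and t: "t \<in> carrier (tensor K M N)"
  shows "(\<lambda>q. tensor_lift K P (f q) t) \<in> mod_hom K Q P"
proof -
  interpret Q: module K Q by fact
  note h = tensor_lift_hom[OF M N P f] and v = tensor_lift_tens[OF M N P f]
  note eq = spans_hom_eq[OF tensor_module[OF M N] P tensor_spans[OF M N], OF h _ _ t]
  show ?thesis
  proof (rule mod_homI)
    fix q q' assume q: "q \<in> carrier Q" "q' \<in> carrier Q"
    show "tensor_lift K P (f (q \<oplus>\<^bsub>Q\<^esub> q')) t = tensor_lift K P (f q) t \<oplus>\<^bsub>P\<^esub> tensor_lift K P (f q') t"
    proof (rule eq[OF _ mod_hom_plus[OF P h h]])
      fix x assume "x \<in> {tens K M N m n | m n. m \<in> carrier M \<and> n \<in> carrier N}"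
      then obtain m n where "x = tens K M N m n" "m \<in> carrier M" "n \<in> carrier N" by auto
      then show "tensor_lift K P (f (q \<oplus>\<^bsub>Q\<^esub> q')) x
          = tensor_lift K P (f q) x \<oplus>\<^bsub>P\<^esub> tensor_lift K P (f q') x"
        using q mod_hom_add[OF fq] by (simp add: v)
    qed (use q in auto)
  next
    fix r q assume q: "r \<in> carrier K" "q \<in> carrier Q"
    show "tensor_lift K P (f (r \<odot>\<^bsub>Q\<^esub> q)) t = r \<odot>\<^bsub>P\<^esub> tensor_lift K P (f q) t"
    proof (rule eq[OF _ mod_hom_scale[OF P h]])
      fix x assume "x \<in> {tens K M N m n | m n. m \<in> carrier M \<and> n \<in> carrier N}"
      then obtain m n where "x = tens K M N m n" "m \<in> carrier M" "n \<in> carrier N" by auto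
      then show "tensor_lift K P (f (r \<odot>\<^bsub>Q\<^esub> q)) x = r \<odot>\<^bsub>P\<^esub> tensor_lift K P (f q) x"
        using q mod_hom_smult[OF fq] by (simp add: v)
    qed (use q in auto)
  qed (rule mod_hom_closed[OF h t])
qed

section \<open>Trilinear maps and threefold tensor products\<close>

definition trilin where
  "trilin K M N L P f \<longleftrightarrow>
    (\<forall>n \<in> carrier N. \<forall>l \<in> carrier L. (\<lambda>m. f m n l) \<in> mod_hom K M P)
    \<and> (\<forall>m \<in> carrier M. \<forall>l \<in> carrier L. (\<lambda>n. f m n l) \<in> mod_hom K N P)
    \<and> (\<forall>m \<in> carrier M. \<forall>n \<in> carrier N. (\<lambda>l. f m n l) \<in> mod_hom K L P)"

lemma trilin_comp:
  assumes "trilin K M N L P f" "g \<in> mod_hom K P Q"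
  shows "trilin K M N L Q (\<lambda>m n l. g (f m n l))"
  using assms(1) by (auto simp: trilin_def intro!: mod_hom_comp[OF _ assms(2)])

definition tens3 where
  "tens3 K M N L m n l = tens K (tensor K M N) L (tens K M N m n) l"

text \<open>Currying: for fixed l the map is bilinear in the first two variables and is lifted; the
  result is bilinear in the tensor and l and is lifted again.\<close>

definition tensor3_lift where
  "tensor3_lift K P f = tensor_lift K P (\<lambda>u l. tensor_lift K P (\<lambda>m n. f m n l) u)"

context
  fixes K :: "('k, 'q) ring_scheme" and M :: "('k, 'm, 's) module_scheme"
    and N :: "('k, 'n, 't) module_scheme" and L :: "('k, 'l, 'v) module_scheme"
  assumes M: "module K M" and N: "module K N" and L: "module K L"
begin

private abbreviation (input) "MN \<equiv> tensor K M N"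
private abbreviation (input) "T3 \<equiv> tensor K (tensor K M N) L"

lemma tensor3_module: "module K T3"
  by (intro tensor_module M N L)

lemma tens3_closed:
  "m \<in> carrier M \<Longrightarrow> n \<in> carrier N \<Longrightarrow> l \<in> carrier L \<Longrightarrow> tens3 K M N L m n l \<in> carrier T3"
  unfolding tens3_def by (intro tens_closed tensor_module M N L)

lemma tensor3_spans: "spans K T3
    {tens3 K M N L m n l | m n l. m \<in> carrier M \<and> n \<in> carrier N \<and> l \<in> carrier L}"
proof -
  have "spans K L (carrier L)" by (simp add: spans_def)
  from tensor_spans_tens[OF tensor_module[OF M N] L tensor_spans[OF M N] this] show ?thesis
    unfolding tens3_def by (rule spans_cong) blast
qed

lemma tens3_trilin: "trilin K M N L T3 (tens3 K M N L)"
proof -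
  have 1: "(\<lambda>u. tens K MN L u l) \<in> mod_hom K MN T3" if "l \<in> carrier L" for l
    using tens_bilin[OF tensor_module[OF M N] L] that by (simp add: bilin_def)
  have 2: "tens K MN L u \<in> mod_hom K L T3" if "u \<in> carrier MN" for u
    using tens_bilin[OF tensor_module[OF M N] L] that by (simp add: bilin_def)
  have 3: "(\<lambda>m. tens K M N m n) \<in> mod_hom K M MN" if "n \<in> carrier N" for n
    using tens_bilin[OF M N] that by (simp add: bilin_def)
  have 4: "tens K M N m \<in> mod_hom K N MN" if "m \<in> carrier M" for m
    using tens_bilin[OF M N] that by (simp add: bilin_def)
  show ?thesis
    unfolding trilin_def tens3_def
    using mod_hom_comp[OF 3 1] mod_hom_comp[OF 4 1] 2 tens_closed[OF M N] by auto
qed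

context
  fixes P :: "('k, 'p, 'u) module_scheme"
  assumes P: "module K P"
begin

lemma trilin_bilin: "trilin K M N L P f \<Longrightarrow> l \<in> carrier L \<Longrightarrow> bilin K M N P (\<lambda>m n. f m n l)"
  by (simp add: trilin_def bilin_def)

text \<open>Linearity in the tensor belongs to the inner lift; linearity in l is
  \<open>tensor_lift_param\<close> with l as the parameter.\<close>

lemma tensor3_inner_bilin:
  assumes f: "trilin K M N L P f"
  shows "bilin K MN L P (\<lambda>u l. tensor_lift K P (\<lambda>m n. f m n l) u)"
  unfolding bilin_def
proof (intro conjI ballI)
  fix l assume "l \<in> carrier L"
  then show "tensor_lift K P (\<lambda>m n. f m n l) \<in> mod_hom K MN P"
    by (rule tensor_lift_hom[OF M N P trilin_bilin[OF f]])
next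
  fix u assume "u \<in> carrier MN"
  then show "(\<lambda>l. tensor_lift K P (\<lambda>m n. f m n l) u) \<in> mod_hom K L P"
    using f by (intro tensor_lift_param[OF M N P L] trilin_bilin[OF f]) (auto simp: trilin_def)
qed

lemma tensor3_lift_hom: "trilin K M N L P f \<Longrightarrow> tensor3_lift K P f \<in> mod_hom K T3 P"
  unfolding tensor3_lift_def
  by (rule tensor_lift_hom[OF tensor_module[OF M N] L P tensor3_inner_bilin])

lemma tensor3_lift_tens3:
  assumes "trilin K M N L P f" "m \<in> carrier M" "n \<in> carrier N" "l \<in> carrier L"
  shows "tensor3_lift K P f (tens3 K M N L m n l) = f m n l"
  unfolding tensor3_lift_def tens3_def using assms
  by (simp add: tensor_lift_tens[OF tensor_module[OF M N] L P tensor3_inner_bilin]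
      tensor_lift_tens[OF M N P trilin_bilin] tens_closed[OF M N])

lemma tensor3_lift_param:
  assumes Q: "module K Q" and f: "\<And>q. q \<in> carrier Q \<Longrightarrow> trilin K M N L P (f q)"
    and fq: "\<And>m n l. m \<in> carrier M \<Longrightarrow> n \<in> carrier N \<Longrightarrow> l \<in> carrier L
      \<Longrightarrow> (\<lambda>q. f q m n l) \<in> mod_hom K Q P"
    and t: "t \<in> carrier T3"
  shows "(\<lambda>q. tensor3_lift K P (f q) t) \<in> mod_hom K Q P"
  unfolding tensor3_lift_def
  by (intro tensor_lift_param[OF tensor_module[OF M N] L P Q tensor3_inner_bilin[OF f] _ t]
      tensor_lift_param[OF M N P Q] trilin_bilin[OF f] fq)

end

end

section \<open>Maps out of the secondary Hochschild complex\<close>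

text \<open>The description is met by the restriction of h, and uniquely so: the values on S fix the
  map on the carrier, extensionality fixes it elsewhere. The abstract predicate \<open>Q\<close>
  stands for the prescribed values in both degrees.\<close>

lemma extensional_hom_the_eq:
  assumes C: "module K C" and P: "module K P" and S: "spans K C S" and h: "h \<in> mod_hom K C P"
    and g: "\<And>g. Q g \<longleftrightarrow> (\<forall>x \<in> S. g x = h x)"
  shows "(THE g. g \<in> mod_hom K C P \<and> g \<in> extensional (carrier C) \<and> Q g) = restrict h (carrier C)"
proof (rule the_equality)
  have "restrict h (carrier C) \<in> mod_hom K C P" by (rule mod_hom_cong[OF C h]) simp
  then show "restrict h (carrier C) \<in> mod_hom K C P \<and> restrict h (carrier C) \<in> extensional (carrier C)
      \<and> Q (restrict h (carrier C))"
    using S by (auto simp: g spans_def)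
  fix g' assume "g' \<in> mod_hom K C P \<and> g' \<in> extensional (carrier C) \<and> Q g'"
  then show "g' = restrict h (carrier C)"
    using spans_hom_eq[OF C P S _ h, of g'] by (intro extensionalityI[of _ "carrier C"]) (auto simp: g)
qed

context
  fixes K :: "('k, 'q) ring_scheme" and A :: "('k, 'a, 's) module_scheme"
    and B :: "('k, 'b, 't) module_scheme"
  assumes A: "module K A" and B: "module K B"
begin

lemma C1_module: "module K (C1 K A B)"
  unfolding C1_def by (intro tensor3_module A B)

lemma C2_module: "module K (C2 K A B)"
  unfolding C2_def by (intro tensor_module tensor3_module A B)

text \<open>The matrix is read row by row, the tensor product has its \<open>A\<close>-factors
  first. Hence the order a, b, \<alpha> in all later \<open>trilin\<close> statements about degree
  1.\<close>

lemma mat2_tens3: "mat2 K A B a \<alpha> b = tens3 K A A B a b \<alpha>"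
  by (simp add: mat2_def tens3_def)

lemma mat3_tens3: "mat3 K A B a \<alpha> \<beta> b \<gamma> c =
    tens K (tensor K (tensor K A A) A) (tensor K (tensor K B B) B)
      (tens3 K A A A a b c) (tens3 K B B B \<alpha> \<beta> \<gamma>)"
  by (simp add: mat3_def tens3_def)

lemma C1_spans: "spans K (C1 K A B)
    {mat2 K A B a \<alpha> b | a \<alpha> b. a \<in> carrier A \<and> \<alpha> \<in> carrier B \<and> b \<in> carrier A}"
  unfolding C1_def mat2_tens3
  by (rule spans_cong[OF tensor3_spans[OF A A B]]) auto

lemma C2_spans: "spans K (C2 K A B)
    {mat3 K A B a \<alpha> \<beta> b \<gamma> c | a \<alpha> \<beta> b \<gamma> c. a \<in> carrier A \<and> \<alpha> \<in> carrier B \<and> \<beta> \<in> carrier B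
      \<and> b \<in> carrier A \<and> \<gamma> \<in> carrier B \<and> c \<in> carrier A}"
  unfolding C2_def mat3_tens3
  by (rule spans_cong[OF tensor_spans_tens[OF tensor3_module[OF A A A] tensor3_module[OF B B B]
          tensor3_spans[OF A A A] tensor3_spans[OF B B B]]]) blast

lemma mat2_trilin: "trilin K A A B (C1 K A B) (\<lambda>a b \<alpha>. mat2 K A B a \<alpha> b)"
  unfolding C1_def mat2_tens3 using tens3_trilin[OF A A B] by (simp add: eta_contract_eq)

text \<open>Linearity in six variables is expressed as two trilinearity statements, one for the
  \<open>A\<close>-entries and one for the \<open>B\<close>-entries, following the two outer factors
  of \<open>C2\<close>.\<close>

lemma mat3_trilin:
  "\<alpha> \<in> carrier B \<Longrightarrow> \<beta> \<in> carrier B \<Longrightarrow> \<gamma> \<in> carrier B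
    \<Longrightarrow> trilin K A A A (C2 K A B) (\<lambda>a b c. mat3 K A B a \<alpha> \<beta> b \<gamma> c)"
  "a \<in> carrier A \<Longrightarrow> b \<in> carrier A \<Longrightarrow> c \<in> carrier A
    \<Longrightarrow> trilin K B B B (C2 K A B) (\<lambda>\<alpha> \<beta> \<gamma>. mat3 K A B a \<alpha> \<beta> b \<gamma> c)"
  unfolding mat3_tens3 C2_def
  using trilin_comp[OF tens3_trilin[OF A A A]] trilin_comp[OF tens3_trilin[OF B B B]]
    tens_bilin[OF tensor3_module[OF A A A] tensor3_module[OF B B B]]
    tens3_closed[OF A A A] tens3_closed[OF B B B]
  unfolding bilin_def by blast+

context
  fixes P :: "('k, 'p, 'u) module_scheme"
  assumes P: "module K P"
begin

lemma C1_lift_exists: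
  assumes f: "trilin K A A B P (\<lambda>a b \<alpha>. f a \<alpha> b)"
  obtains h where "h \<in> mod_hom K (C1 K A B) P"
    and "\<And>a \<alpha> b. a \<in> carrier A \<Longrightarrow> \<alpha> \<in> carrier B \<Longrightarrow> b \<in> carrier A \<Longrightarrow> h (mat2 K A B a \<alpha> b) = f a \<alpha> b"
  using tensor3_lift_hom[OF A A B P f] tensor3_lift_tens3[OF A A B P f] that
  by (simp add: C1_def mat2_tens3)

lemma C1_linear_map:
  assumes f: "trilin K A A B P (\<lambda>a b \<alpha>. f a \<alpha> b)"
  shows "C1_linear_map K A B P f \<in> mod_hom K (C1 K A B) P"
    and "\<And>a \<alpha> b. a \<in> carrier A \<Longrightarrow> \<alpha> \<in> carrier B \<Longrightarrow> b \<in> carrier A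
      \<Longrightarrow> C1_linear_map K A B P f (mat2 K A B a \<alpha> b) = f a \<alpha> b"
proof -
  obtain h where h: "h \<in> mod_hom K (C1 K A B) P"
    and v: "\<And>a \<alpha> b. a \<in> carrier A \<Longrightarrow> \<alpha> \<in> carrier B \<Longrightarrow> b \<in> carrier A \<Longrightarrow> h (mat2 K A B a \<alpha> b) = f a \<alpha> b"
    using C1_lift_exists[OF f] by blast
  have eq: "C1_linear_map K A B P f = restrict h (carrier (C1 K A B))"
    unfolding C1_linear_map_def
  proof (rule extensional_hom_the_eq[OF C1_module P C1_spans h], intro iffI ballI, goal_cases)
    case (1 g x)
    then show ?case using v by auto
  next
    case 2
    then show ?case by (subst v[symmetric]) blast+
  qed
  show "C1_linear_map K A B P f \<in> mod_hom K (C1 K A B) P"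
    unfolding eq by (rule mod_hom_cong[OF C1_module h]) simp
  show "C1_linear_map K A B P f (mat2 K A B a \<alpha> b) = f a \<alpha> b"
    if "a \<in> carrier A" "\<alpha> \<in> carrier B" "b \<in> carrier A" for a \<alpha> b
  proof -
    have "mat2 K A B a \<alpha> b \<in> carrier (C1 K A B)"
      using that C1_spans unfolding spans_def by blast
    with v[OF that] show ?thesis by (simp add: eq)
  qed
qed

text \<open>Three nested lifts: over the \<open>B\<close>-entries with a, b, c fixed, then over the
  \<open>A\<close>-entries with the \<open>B\<close>-tensor s fixed, and finally over the pair of
  tensors, on which the result is bilinear.\<close>

lemma C2_lift_exists:
  assumes fA: "\<And>\<alpha> \<beta> \<gamma>. \<alpha> \<in> carrier B \<Longrightarrow> \<beta> \<in> carrier B \<Longrightarrow> \<gamma> \<in> carrier B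
      \<Longrightarrow> trilin K A A A P (\<lambda>a b c. f a \<alpha> \<beta> b \<gamma> c)"
    and fB: "\<And>a b c. a \<in> carrier A \<Longrightarrow> b \<in> carrier A \<Longrightarrow> c \<in> carrier A
      \<Longrightarrow> trilin K B B B P (\<lambda>\<alpha> \<beta> \<gamma>. f a \<alpha> \<beta> b \<gamma> c)"
  obtains h where "h \<in> mod_hom K (C2 K A B) P"
    and "\<And>a \<alpha> \<beta> b \<gamma> c. a \<in> carrier A \<Longrightarrow> \<alpha> \<in> carrier B \<Longrightarrow> \<beta> \<in> carrier B \<Longrightarrow> b \<in> carrier A
      \<Longrightarrow> \<gamma> \<in> carrier B \<Longrightarrow> c \<in> carrier A \<Longrightarrow> h (mat3 K A B a \<alpha> \<beta> b \<gamma> c) = f a \<alpha> \<beta> b \<gamma> c"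
proof -
  let ?g = "\<lambda>s a b c. tensor3_lift K P (\<lambda>\<alpha> \<beta> \<gamma>. f a \<alpha> \<beta> b \<gamma> c) s"
  \<comment> \<open>Taking one of \<open>a'\<close>, \<open>b'\<close>, \<open>c'\<close> to be the
    identity and the other two constant yields linearity in each of the three slots from a single
    statement.\<close>
  have param: "(\<lambda>q. ?g s (a' q) (b' q) (c' q)) \<in> mod_hom K A P"
    if "s \<in> carrier (tensor K (tensor K B B) B)"
      "\<And>q. q \<in> carrier A \<Longrightarrow> a' q \<in> carrier A \<and> b' q \<in> carrier A \<and> c' q \<in> carrier A"
      "\<And>\<alpha> \<beta> \<gamma>. \<alpha> \<in> carrier B \<Longrightarrow> \<beta> \<in> carrier B \<Longrightarrow> \<gamma> \<in> carrier B
        \<Longrightarrow> (\<lambda>q. f (a' q) \<alpha> \<beta> (b' q) \<gamma> (c' q)) \<in> mod_hom K A P" for s a' b' c'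
    using that by (intro tensor3_lift_param[OF B B B P A fB]) auto
  have gA: "trilin K A A A P (?g s)" if "s \<in> carrier (tensor K (tensor K B B) B)" for s
    unfolding trilin_def using that fA by (auto intro!: param simp: trilin_def)
  have gB: "(\<lambda>s. ?g s a b c) \<in> mod_hom K (tensor K (tensor K B B) B) P"
    if "a \<in> carrier A" "b \<in> carrier A" "c \<in> carrier A" for a b c
    using tensor3_lift_hom[OF B B B P fB[OF that]] by simp
  have bl: "bilin K (tensor K (tensor K A A) A) (tensor K (tensor K B B) B) P
      (\<lambda>t s. tensor3_lift K P (?g s) t)"
    unfolding bilin_def
    using tensor3_lift_hom[OF A A A P gA]
      tensor3_lift_param[OF A A A P tensor3_module[OF B B B] gA gB] by auto
  show ?thesis
  proof (rule that)
    show "tensor_lift K P (\<lambda>t s. tensor3_lift K P (?g s) t) \<in> mod_hom K (C2 K A B) P"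
      unfolding C2_def by (rule tensor_lift_hom[OF tensor3_module[OF A A A] tensor3_module[OF B B B] P bl])
  qed (simp add: mat3_tens3 tensor_lift_tens[OF tensor3_module[OF A A A] tensor3_module[OF B B B] P bl]
      tens3_closed[OF A A A] tens3_closed[OF B B B] tensor3_lift_tens3[OF A A A P gA]
      tensor3_lift_tens3[OF B B B P fB])
qed

lemma C2_linear_map:
  assumes fA: "\<And>\<alpha> \<beta> \<gamma>. \<alpha> \<in> carrier B \<Longrightarrow> \<beta> \<in> carrier B \<Longrightarrow> \<gamma> \<in> carrier B
      \<Longrightarrow> trilin K A A A P (\<lambda>a b c. f a \<alpha> \<beta> b \<gamma> c)"
    and fB: "\<And>a b c. a \<in> carrier A \<Longrightarrow> b \<in> carrier A \<Longrightarrow> c \<in> carrier A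
      \<Longrightarrow> trilin K B B B P (\<lambda>\<alpha> \<beta> \<gamma>. f a \<alpha> \<beta> b \<gamma> c)"
  shows "C2_linear_map K A B P f \<in> mod_hom K (C2 K A B) P"
    and "\<And>a \<alpha> \<beta> b \<gamma> c. a \<in> carrier A \<Longrightarrow> \<alpha> \<in> carrier B \<Longrightarrow> \<beta> \<in> carrier B \<Longrightarrow> b \<in> carrier A
      \<Longrightarrow> \<gamma> \<in> carrier B \<Longrightarrow> c \<in> carrier A
      \<Longrightarrow> C2_linear_map K A B P f (mat3 K A B a \<alpha> \<beta> b \<gamma> c) = f a \<alpha> \<beta> b \<gamma> c"
proof -
  obtain h where h: "h \<in> mod_hom K (C2 K A B) P"
    and v: "\<And>a \<alpha> \<beta> b \<gamma> c. a \<in> carrier A \<Longrightarrow> \<alpha> \<in> carrier B \<Longrightarrow> \<beta> \<in> carrier B \<Longrightarrow> b \<in> carrier A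
      \<Longrightarrow> \<gamma> \<in> carrier B \<Longrightarrow> c \<in> carrier A \<Longrightarrow> h (mat3 K A B a \<alpha> \<beta> b \<gamma> c) = f a \<alpha> \<beta> b \<gamma> c"
    using C2_lift_exists[OF fA fB] by blast
  have eq: "C2_linear_map K A B P f = restrict h (carrier (C2 K A B))"
    unfolding C2_linear_map_def
  proof (rule extensional_hom_the_eq[OF C2_module P C2_spans h], intro iffI ballI, goal_cases)
    case (1 g x)
    then show ?case using v by auto
  next
    case 2
    then show ?case by (subst v[symmetric]) blast+
  qed
  show "C2_linear_map K A B P f \<in> mod_hom K (C2 K A B) P"
    unfolding eq by (rule mod_hom_cong[OF C2_module h]) simp
  show "C2_linear_map K A B P f (mat3 K A B a \<alpha> \<beta> b \<gamma> c) = f a \<alpha> \<beta> b \<gamma> c"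
    if "a \<in> carrier A" "\<alpha> \<in> carrier B" "\<beta> \<in> carrier B" "b \<in> carrier A" "\<gamma> \<in> carrier B" "c \<in> carrier A"
    for a \<alpha> \<beta> b \<gamma> c
  proof -
    have "mat3 K A B a \<alpha> \<beta> b \<gamma> c \<in> carrier (C2 K A B)"
      using that C2_spans unfolding spans_def by blast
    with v[OF that] show ?thesis by (simp add: eq)
  qed
qed

end

end

section \<open>First secondary cyclic homology of a commutative triple\<close>

lemma algebra_mult_hom:
  assumes A: "algebra K A" and f: "f \<in> mod_hom K Q A" and c: "c \<in> carrier A"
  shows "(\<lambda>x. f x \<otimes>\<^bsub>A\<^esub> c) \<in> mod_hom K Q A" and "(\<lambda>x. c \<otimes>\<^bsub>A\<^esub> f x) \<in> mod_hom K Q A"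
proof -
  interpret Ar: cring A by (rule algebra.M_cring[OF A])
  interpret A: algebra K A by fact
  show 1: "(\<lambda>x. f x \<otimes>\<^bsub>A\<^esub> c) \<in> mod_hom K Q A"
    using c by (intro mod_homI)
      (auto simp: mod_hom_closed[OF f] mod_hom_add[OF f] mod_hom_smult[OF f] Ar.l_distr A.smult_assoc2)
  show "(\<lambda>x. c \<otimes>\<^bsub>A\<^esub> f x) \<in> mod_hom K Q A"
    using c by (intro mod_homI)
      (auto simp: mod_hom_closed[OF f] mod_hom_add[OF f] mod_hom_smult[OF f] Ar.r_distr
        Ar.m_comm[of c] A.smult_assoc2)
qed

lemma im_one_minus_submodule:
  assumes M: "module K M" and t: "t \<in> mod_hom K M M"
  shows "submodule (im_one_minus M t) K M"
  unfolding im_one_minus_def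
  by (rule submodule_image[OF M M mod_hom_diff[OF M mod_hom_id t] module.carrier_is_submodule[OF M]])

text \<open>Commutativity of \<open>A\<close> and \<open>B\<close> is contained in
  \<open>algebra\<close>.\<close>

locale commutative_triple =
  fixes K :: "'k ring" and A :: "('k, 'a) module" and B :: "('k, 'b) module" and \<epsilon> :: "'b \<Rightarrow> 'a"
  assumes algA: "algebra K A" and algB: "algebra K B" and eps: "\<epsilon> \<in> algebra_hom K B A"
begin

sublocale Ar: cring A by (rule algebra.M_cring[OF algA])
sublocale Br: cring B by (rule algebra.M_cring[OF algB])
sublocale A: algebra K A by (rule algA)
sublocale B: algebra K B by (rule algB)

lemma modA: "module K A" by (rule A.module)
lemma modB: "module K B" by (rule B.module)

lemma eps_hom: "\<epsilon> \<in> mod_hom K B A" and eps_ring_hom: "\<epsilon> \<in> ring_hom B A"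
  using eps by (auto simp: algebra_hom_def)

lemma eps_closed [simp]: "\<alpha> \<in> carrier B \<Longrightarrow> \<epsilon> \<alpha> \<in> carrier A"
  and eps_mult [simp]: "\<alpha> \<in> carrier B \<Longrightarrow> \<beta> \<in> carrier B \<Longrightarrow> \<epsilon> (\<alpha> \<otimes>\<^bsub>B\<^esub> \<beta>) = \<epsilon> \<alpha> \<otimes>\<^bsub>A\<^esub> \<epsilon> \<beta>"
  and eps_one [simp]: "\<epsilon> \<one>\<^bsub>B\<^esub> = \<one>\<^bsub>A\<^esub>"
  using eps_ring_hom by (auto simp: ring_hom_def)

abbreviation "CC1 \<equiv> C1 K A B"
abbreviation "CC2 \<equiv> C2 K A B"
abbreviation "mt2 \<equiv> mat2 K A B"
abbreviation "mt3 \<equiv> mat3 K A B"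
abbreviation "N1 \<equiv> im_one_minus CC1 (cyc1 K A B)"
abbreviation "N2 \<equiv> im_one_minus CC2 (cyc2 K A B)"

lemmas C1_mod = C1_module[OF modA modB]
lemmas C2_mod = C2_module[OF modA modB]

sublocale C1: module K CC1 by (rule C1_mod)

lemma mat2_hom:
  "f \<in> mod_hom K Q A \<Longrightarrow> \<alpha> \<in> carrier B \<Longrightarrow> b \<in> carrier A \<Longrightarrow> (\<lambda>x. mt2 (f x) \<alpha> b) \<in> mod_hom K Q CC1"
  "a \<in> carrier A \<Longrightarrow> g \<in> mod_hom K Q B \<Longrightarrow> b \<in> carrier A \<Longrightarrow> (\<lambda>x. mt2 a (g x) b) \<in> mod_hom K Q CC1"
  "a \<in> carrier A \<Longrightarrow> \<alpha> \<in> carrier B \<Longrightarrow> f \<in> mod_hom K Q A \<Longrightarrow> (\<lambda>x. mt2 a \<alpha> (f x)) \<in> mod_hom K Q CC1"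
  using mat2_trilin[OF modA modB] mod_hom_comp[of f K Q A "\<lambda>a. mt2 a \<alpha> b" CC1]
    mod_hom_comp[of g K Q B "\<lambda>\<alpha>. mt2 a \<alpha> b" CC1] mod_hom_comp[of f K Q A "\<lambda>b. mt2 a \<alpha> b" CC1]
  by (simp_all add: trilin_def)

lemma mat2_closed [simp]:
  "a \<in> carrier A \<Longrightarrow> \<alpha> \<in> carrier B \<Longrightarrow> b \<in> carrier A \<Longrightarrow> mt2 a \<alpha> b \<in> carrier CC1"
  using mod_hom_closed[OF mat2_hom(1)[OF mod_hom_id]] by blast

text \<open>Rules following the shape of a term: linearity in one matrix entry is reduced to
  linearity of the identity map.\<close>

lemmas lin_intros = mat2_hom algebra_mult_hom[OF algA] algebra_mult_hom[OF algB]
  mod_hom_comp[OF _ eps_hom] mod_hom_plus[OF C1_mod] mod_hom_diff[OF C1_mod] mod_hom_neg[OF C1_mod]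

lemma cyc1_trilin: "trilin K A A B CC1 (\<lambda>a b \<alpha>. \<ominus>\<^bsub>CC1\<^esub> mt2 b \<alpha> a)"
  by (auto simp: trilin_def intro!: lin_intros mod_hom_id)

lemma cyc1_hom: "cyc1 K A B \<in> mod_hom K CC1 CC1"
  and cyc1_mat2: "a \<in> carrier A \<Longrightarrow> \<alpha> \<in> carrier B \<Longrightarrow> b \<in> carrier A
    \<Longrightarrow> cyc1 K A B (mt2 a \<alpha> b) = \<ominus>\<^bsub>CC1\<^esub> mt2 b \<alpha> a"
  unfolding cyc1_def using C1_linear_map[OF modA modB C1_mod cyc1_trilin] by auto

lemma cyc2_hom: "cyc2 K A B \<in> mod_hom K CC2 CC2"
  and cyc2_mat3: "a \<in> carrier A \<Longrightarrow> \<alpha> \<in> carrier B \<Longrightarrow> \<beta> \<in> carrier B \<Longrightarrow> b \<in> carrier A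
    \<Longrightarrow> \<gamma> \<in> carrier B \<Longrightarrow> c \<in> carrier A
    \<Longrightarrow> cyc2 K A B (mt3 a \<alpha> \<beta> b \<gamma> c) = mt3 c \<beta> \<gamma> a \<alpha> b"
proof -
  have A: "trilin K A A A CC2 (\<lambda>a b c. mt3 c \<beta> \<gamma> a \<alpha> b)"
    if "\<alpha> \<in> carrier B" "\<beta> \<in> carrier B" "\<gamma> \<in> carrier B" for \<alpha> \<beta> \<gamma>
    using mat3_trilin(1)[OF modA modB that(2,3,1)] by (auto simp: trilin_def)
  have B: "trilin K B B B CC2 (\<lambda>\<alpha> \<beta> \<gamma>. mt3 c \<beta> \<gamma> a \<alpha> b)"
    if "a \<in> carrier A" "b \<in> carrier A" "c \<in> carrier A" for a b c
    using mat3_trilin(2)[OF modA modB that(3,1,2)] by (auto simp: trilin_def)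
  show "cyc2 K A B \<in> mod_hom K CC2 CC2"
    unfolding cyc2_def by (rule C2_linear_map(1)[OF modA modB C2_mod A B])
  show "a \<in> carrier A \<Longrightarrow> \<alpha> \<in> carrier B \<Longrightarrow> \<beta> \<in> carrier B \<Longrightarrow> b \<in> carrier A
    \<Longrightarrow> \<gamma> \<in> carrier B \<Longrightarrow> c \<in> carrier A
    \<Longrightarrow> cyc2 K A B (mt3 a \<alpha> \<beta> b \<gamma> c) = mt3 c \<beta> \<gamma> a \<alpha> b"
    unfolding cyc2_def by (rule C2_linear_map(2)[OF modA modB C2_mod A B])
qed

text \<open>The prescribed value of the second boundary map on an elementary tensor, named so that
  \<open>bd2_def\<close> can be folded to it.\<close>

definition hoch where
  "hoch a \<alpha> \<beta> b \<gamma> c = (mt2 (a \<otimes>\<^bsub>A\<^esub> \<epsilon> \<alpha> \<otimes>\<^bsub>A\<^esub> b) (\<beta> \<otimes>\<^bsub>B\<^esub> \<gamma>) c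
      \<ominus>\<^bsub>CC1\<^esub> mt2 a (\<alpha> \<otimes>\<^bsub>B\<^esub> \<beta>) (b \<otimes>\<^bsub>A\<^esub> \<epsilon> \<gamma> \<otimes>\<^bsub>A\<^esub> c))
      \<oplus>\<^bsub>CC1\<^esub> mt2 (c \<otimes>\<^bsub>A\<^esub> \<epsilon> \<beta> \<otimes>\<^bsub>A\<^esub> a) (\<alpha> \<otimes>\<^bsub>B\<^esub> \<gamma>) b"

lemma bd2_hom: "bd2 K A B \<epsilon> \<in> mod_hom K CC2 CC1"
  and bd2_mat3: "a \<in> carrier A \<Longrightarrow> \<alpha> \<in> carrier B \<Longrightarrow> \<beta> \<in> carrier B \<Longrightarrow> b \<in> carrier A
    \<Longrightarrow> \<gamma> \<in> carrier B \<Longrightarrow> c \<in> carrier A \<Longrightarrow> bd2 K A B \<epsilon> (mt3 a \<alpha> \<beta> b \<gamma> c) = hoch a \<alpha> \<beta> b \<gamma> c"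
proof -
  have A: "trilin K A A A CC1 (\<lambda>a b c. hoch a \<alpha> \<beta> b \<gamma> c)"
    if "\<alpha> \<in> carrier B" "\<beta> \<in> carrier B" "\<gamma> \<in> carrier B" for \<alpha> \<beta> \<gamma>
    unfolding hoch_def trilin_def using that
    by (intro conjI ballI lin_intros mod_hom_id) auto
  have B: "trilin K B B B CC1 (\<lambda>\<alpha> \<beta> \<gamma>. hoch a \<alpha> \<beta> b \<gamma> c)"
    if "a \<in> carrier A" "b \<in> carrier A" "c \<in> carrier A" for a b c
    unfolding hoch_def trilin_def using that
    by (intro conjI ballI lin_intros mod_hom_id) auto
  show "bd2 K A B \<epsilon> \<in> mod_hom K CC2 CC1"
    unfolding bd2_def hoch_def[symmetric] by (rule C2_linear_map(1)[OF modA modB C1_mod A B])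
  show "a \<in> carrier A \<Longrightarrow> \<alpha> \<in> carrier B \<Longrightarrow> \<beta> \<in> carrier B \<Longrightarrow> b \<in> carrier A
    \<Longrightarrow> \<gamma> \<in> carrier B \<Longrightarrow> c \<in> carrier A \<Longrightarrow> bd2 K A B \<epsilon> (mt3 a \<alpha> \<beta> b \<gamma> c) = hoch a \<alpha> \<beta> b \<gamma> c"
    unfolding bd2_def hoch_def[symmetric] by (rule C2_linear_map(2)[OF modA modB C1_mod A B])
qed

lemma zero_hom: "module K P \<Longrightarrow> (\<lambda>_. \<zero>\<^bsub>P\<^esub>) \<in> mod_hom K Q P"
proof -
  assume "module K P"
  then interpret P: module K P .
  show ?thesis by (rule mod_homI) auto
qed

lemma bd1_zero:
  assumes "x \<in> carrier CC1"
  shows "bd1 K A B \<epsilon> x = \<zero>\<^bsub>A\<^esub>"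
proof -
  define f where "f a \<alpha> b = (a \<otimes>\<^bsub>A\<^esub> \<epsilon> \<alpha> \<otimes>\<^bsub>A\<^esub> b) \<ominus>\<^bsub>A\<^esub> (b \<otimes>\<^bsub>A\<^esub> \<epsilon> \<alpha> \<otimes>\<^bsub>A\<^esub> a)" for a \<alpha> b
  have f0: "f a \<alpha> b = \<zero>\<^bsub>A\<^esub>" if "a \<in> carrier A" "\<alpha> \<in> carrier B" "b \<in> carrier A" for a \<alpha> b
    using that by (simp add: f_def Ar.diff_eq_zero_iff Ar.m_ac)
  \<comment> \<open>On the carriers f agrees with the zero map in every slot, and agreement there is
    enough for linearity.\<close>
  have tri: "trilin K A A B A (\<lambda>a b \<alpha>. f a \<alpha> b)"
    unfolding trilin_def
    by (intro conjI ballI mod_hom_cong[OF _ zero_hom[OF modA]] modA modB) (auto simp: f0)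
  have hom: "bd1 K A B \<epsilon> \<in> mod_hom K CC1 A"
    and val: "\<And>a \<alpha> b. a \<in> carrier A \<Longrightarrow> \<alpha> \<in> carrier B \<Longrightarrow> b \<in> carrier A \<Longrightarrow> bd1 K A B \<epsilon> (mt2 a \<alpha> b) = f a \<alpha> b"
    unfolding bd1_def C0_def f_def[symmetric] using C1_linear_map[OF modA modB modA tri] by auto
  show ?thesis
    by (rule spans_hom_eq[OF C1_mod modA C1_spans[OF modA modB] hom zero_hom[OF modA] _ assms])
      (auto simp: val f0)
qed

section \<open>The cyclic quotient in degree 1 and its boundaries\<close>

lemmas N1_sub = im_one_minus_submodule[OF C1_mod cyc1_hom]
lemmas N2_sub = im_one_minus_submodule[OF C2_mod cyc2_hom]

abbreviation "CQ1 \<equiv> quot_module CC1 N1"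
abbreviation "cls1 x \<equiv> N1 +>\<^bsub>CC1\<^esub> x"

lemmas CQ1_mod = quot_module_module[OF C1_mod N1_sub]
lemmas cls1_hom = quot_proj_hom[OF C1_mod N1_sub]

sublocale CQ1: module K CQ1 by (rule CQ1_mod)

text \<open>The sign in the action of \<lambda> on degree 1 turns x - \<lambda>(x) into the sum of
  an elementary tensor and its transpose.\<close>

lemma cls1_antisym:
  assumes "a \<in> carrier A" "\<alpha> \<in> carrier B" "b \<in> carrier A"
  shows "cls1 (mt2 a \<alpha> b) \<oplus>\<^bsub>CQ1\<^esub> cls1 (mt2 b \<alpha> a) = \<zero>\<^bsub>CQ1\<^esub>"
proof -
  have "mt2 a \<alpha> b \<ominus>\<^bsub>CC1\<^esub> cyc1 K A B (mt2 a \<alpha> b) \<in> N1"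
    unfolding im_one_minus_def using assms by (intro imageI) auto
  then have "mt2 a \<alpha> b \<oplus>\<^bsub>CC1\<^esub> mt2 b \<alpha> a \<in> N1"
    using assms by (simp add: cyc1_mat2 a_minus_def)
  then show ?thesis
    using assms by (subst mod_hom_add[OF cls1_hom, symmetric]) (auto simp: quot_zero_iff[OF C1_mod N1_sub])
qed

text \<open>The boundary descends because its class in \<open>CQ1\<close> does not change when the
  matrix is rotated by \<lambda>; so it vanishes on each y - \<lambda>(y).\<close>

lemma bd2_N2:
  assumes "x \<in> N2"
  shows "bd2 K A B \<epsilon> x \<in> N1"
proof -
  interpret C2: module K CC2 by (rule C2_mod)
  let ?d = "\<lambda>x. cls1 (bd2 K A B \<epsilon> x)"
  have dh: "?d \<in> mod_hom K CC2 CQ1" by (rule mod_hom_comp[OF bd2_hom cls1_hom])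
  have cyc: "?d (cyc2 K A B y) = ?d y" if "y \<in> carrier CC2" for y
  proof (rule spans_hom_eq[OF C2_mod CQ1_mod C2_spans[OF modA modB] mod_hom_comp[OF cyc2_hom dh] dh _ that])
    fix y assume "y \<in> {mt3 a \<alpha> \<beta> b \<gamma> c | a \<alpha> \<beta> b \<gamma> c. a \<in> carrier A \<and> \<alpha> \<in> carrier B \<and> \<beta> \<in> carrier B
      \<and> b \<in> carrier A \<and> \<gamma> \<in> carrier B \<and> c \<in> carrier A}"
    then obtain a \<alpha> \<beta> b \<gamma> c where y: "y = mt3 a \<alpha> \<beta> b \<gamma> c" and
      c: "a \<in> carrier A" "\<alpha> \<in> carrier B" "\<beta> \<in> carrier B" "b \<in> carrier A" "\<gamma> \<in> carrier B" "c \<in> carrier A"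
      by auto
    have neg: "cls1 (mt2 a \<alpha> b) = \<ominus>\<^bsub>CQ1\<^esub> cls1 (mt2 b \<alpha> a)"
      if "a \<in> carrier A" "\<alpha> \<in> carrier B" "b \<in> carrier A" for a \<alpha> b
      using cls1_antisym[OF that] that
      by (intro CQ1.M.minus_equality[symmetric]) (auto intro: mod_hom_closed[OF cls1_hom])
    \<comment> \<open>Rotation permutes the three terms: the first term of the rotated boundary is
      the old third one, its second and third terms are the old first and second ones after
      antisymmetry.\<close>
    have "cls1 (hoch a \<alpha> \<beta> b \<gamma> c) = cls1 (hoch c \<beta> \<gamma> a \<alpha> b)"
      unfolding hoch_def
      using c neg[of "a \<otimes>\<^bsub>A\<^esub> \<epsilon> \<alpha> \<otimes>\<^bsub>A\<^esub> b" "\<beta> \<otimes>\<^bsub>B\<^esub> \<gamma>" c]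
        neg[of a "\<alpha> \<otimes>\<^bsub>B\<^esub> \<beta>" "b \<otimes>\<^bsub>A\<^esub> \<epsilon> \<gamma> \<otimes>\<^bsub>A\<^esub> c"]
      by (simp add: mod_hom_add[OF cls1_hom] mod_hom_uminus[OF C1_mod CQ1_mod cls1_hom]
          mod_hom_closed[OF cls1_hom] a_minus_def CQ1.M.a_ac Br.m_comm)
    then show "?d (cyc2 K A B y) = ?d y"
      using c by (simp add: y cyc2_mat3 bd2_mat3)
  qed
  obtain y where y: "y \<in> carrier CC2" "x = y \<ominus>\<^bsub>CC2\<^esub> cyc2 K A B y"
    using assms by (auto simp: im_one_minus_def)
  have xc: "x \<in> carrier CC2" using y mod_hom_closed[OF cyc2_hom] by simp
  have "?d x = \<zero>\<^bsub>CQ1\<^esub>"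
    using y cyc mod_hom_closed[OF cyc2_hom] mod_hom_closed[OF dh]
    by (simp add: mod_hom_minus[OF C2_mod CQ1_mod dh] CQ1.M.diff_eq_zero_iff)
  then show ?thesis
    using quot_zero_iff[OF C1_mod N1_sub] mod_hom_closed[OF bd2_hom xc] by simp
qed

text \<open>The image is taken over representatives in \<open>CC2\<close> instead of cosets;
  \<open>HC1_eq\<close> identifies it with the image of \<open>bd2cyc\<close>.\<close>

definition "Bdry = (\<lambda>x. cls1 (bd2 K A B \<epsilon> x)) ` carrier CC2"

lemma Bdry_sub: "submodule Bdry K CQ1"
  unfolding Bdry_def
  by (rule submodule_image[OF C2_mod CQ1_mod mod_hom_comp[OF bd2_hom cls1_hom]
        module.carrier_is_submodule[OF C2_mod]])

text \<open>As \<open>bd1\<close> vanishes, every class is a cycle, so replacing the carrier by the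
  kernel changes nothing and only the division by boundaries remains.\<close>

lemma HC1_eq: "HC1 K A B \<epsilon> = quot_module CQ1 Bdry"
proof -
  \<comment> \<open>In degree 0 the generator \<lambda> is the identity, so 1 - \<lambda> is zero
    and the quotient merely turns elements into singletons.\<close>
  have "im_one_minus A cyc0 = (\<lambda>x. \<zero>\<^bsub>A\<^esub>) ` carrier A"
    unfolding im_one_minus_def by (rule image_cong) (auto simp: cyc0_def Ar.diff_eq_zero_iff)
  then have N0: "im_one_minus A cyc0 = {\<zero>\<^bsub>A\<^esub>}"
    using image_constant[OF Ar.zero_closed] by simp
  have "bd1cyc K A B \<epsilon> X = {\<zero>\<^bsub>A\<^esub>}" if "X \<in> carrier CQ1" for X
  proof -
    from that[unfolded quot_carrier[OF C1_mod N1_sub]]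
    obtain x where x: "X = cls1 x" "x \<in> carrier CC1" by (rule imageE)
    have "bd1 K A B \<epsilon> y = \<zero>\<^bsub>A\<^esub>" if "y \<in> X" for y
      using quot_elem(1)[OF C1_mod N1_sub x(2)] that x(1) by (simp add: bd1_zero)
    then have "(\<Union>y \<in> X. {\<zero>\<^bsub>A\<^esub>} +>\<^bsub>A\<^esub> bd1 K A B \<epsilon> y) = (\<Union>y \<in> X. {\<zero>\<^bsub>A\<^esub>})"
      by (intro SUP_cong[OF refl]) (simp add: a_r_coset_def')
    moreover have "X \<noteq> {}" using coset_self[OF C1_mod N1_sub x(2)] x(1) by blast
    ultimately show ?thesis
      by (simp add: bd1cyc_def induced_map_def C0_def N0)
  qed
  moreover have "\<zero>\<^bsub>C0cyc K A B\<^esub> = {\<zero>\<^bsub>A\<^esub>}"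
    by (simp add: C0cyc_def quot_module_def C0_def N0)
  ultimately have ker: "a_kernel (C1cyc K A B) (C0cyc K A B) (bd1cyc K A B \<epsilon>) = carrier CQ1"
    unfolding a_kernel_def' C1cyc_def by auto
  have "bd2cyc K A B \<epsilon> ` carrier (C2cyc K A B) = Bdry"
    unfolding bd2cyc_def C2cyc_def quot_carrier[OF C2_mod N2_sub] image_image Bdry_def
    by (rule image_cong[OF refl], rule induced_map_coset[OF C2_mod N2_sub C1_mod N1_sub bd2_hom bd2_N2])
  then show ?thesis
    unfolding HC1_def ker by (simp add: C1cyc_def)
qed

section \<open>First cyclic homology by generators and relations\<close>

abbreviation "HH \<equiv> HC1 K A B \<epsilon>"

text \<open>The class written [a, \<alpha>, b] in the overview, passing through both
  quotients.\<close>

definition hc_class where "hc_class a \<alpha> b = Bdry +>\<^bsub>CQ1\<^esub> (cls1 (mt2 a \<alpha> b))"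

lemma HC1_mod: "module K HH"
  unfolding HC1_eq by (rule quot_module_module[OF CQ1_mod Bdry_sub])

sublocale H: module K HH by (rule HC1_mod)

lemma HC1_proj_hom: "(\<lambda>x. Bdry +>\<^bsub>CQ1\<^esub> (cls1 x)) \<in> mod_hom K CC1 HH"
  unfolding HC1_eq by (rule mod_hom_comp[OF cls1_hom quot_proj_hom[OF CQ1_mod Bdry_sub]])

lemma HC1_spans: "spans K HH
    {hc_class a \<alpha> b | a \<alpha> b. a \<in> carrier A \<and> \<alpha> \<in> carrier B \<and> b \<in> carrier A}"
  unfolding HC1_eq hc_class_def
  by (rule spans_cong[OF quot_spans[OF CQ1_mod Bdry_sub quot_spans[OF C1_mod N1_sub C1_spans[OF modA modB]]]])
    blast

lemma hc_class_hom:
  "f \<in> mod_hom K Q A \<Longrightarrow> \<alpha> \<in> carrier B \<Longrightarrow> b \<in> carrier A \<Longrightarrow> (\<lambda>x. hc_class (f x) \<alpha> b) \<in> mod_hom K Q HH"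
  "a \<in> carrier A \<Longrightarrow> g \<in> mod_hom K Q B \<Longrightarrow> b \<in> carrier A \<Longrightarrow> (\<lambda>x. hc_class a (g x) b) \<in> mod_hom K Q HH"
  "a \<in> carrier A \<Longrightarrow> \<alpha> \<in> carrier B \<Longrightarrow> f \<in> mod_hom K Q A \<Longrightarrow> (\<lambda>x. hc_class a \<alpha> (f x)) \<in> mod_hom K Q HH"
  unfolding hc_class_def by (rule mod_hom_comp[OF _ HC1_proj_hom], rule mat2_hom; assumption)+

lemma hc_class_closed [simp]:
  "a \<in> carrier A \<Longrightarrow> \<alpha> \<in> carrier B \<Longrightarrow> b \<in> carrier A \<Longrightarrow> hc_class a \<alpha> b \<in> carrier HH"
  using mod_hom_closed[OF hc_class_hom(1)[OF mod_hom_id]] by blast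

lemma hc_class_antisym:
  assumes "a \<in> carrier A" "\<alpha> \<in> carrier B" "b \<in> carrier A"
  shows "hc_class a \<alpha> b \<oplus>\<^bsub>HH\<^esub> hc_class b \<alpha> a = \<zero>\<^bsub>HH\<^esub>"
proof -
  have "hc_class a \<alpha> b \<oplus>\<^bsub>HH\<^esub> hc_class b \<alpha> a = Bdry +>\<^bsub>CQ1\<^esub> (cls1 (mt2 a \<alpha> b) \<oplus>\<^bsub>CQ1\<^esub> cls1 (mt2 b \<alpha> a))"
    unfolding hc_class_def HC1_eq using assms
    by (intro quot_add[OF CQ1_mod Bdry_sub] mod_hom_closed[OF cls1_hom]) auto
  then show ?thesis
    using assms mod_hom_zero[OF CQ1_mod HC1_mod[unfolded HC1_eq] quot_proj_hom[OF CQ1_mod Bdry_sub]]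
    by (simp add: cls1_antisym HC1_eq)
qed

text \<open>The boundary of an elementary tensor is zero in homology. The negative term is moved to
  the other side, so that instances with entries 1 read directly as sum formulas.\<close>

lemma hc_class_hoch:
  assumes "a \<in> carrier A" "\<alpha> \<in> carrier B" "\<beta> \<in> carrier B" "b \<in> carrier A" "\<gamma> \<in> carrier B" "c \<in> carrier A"
  shows "hc_class (a \<otimes>\<^bsub>A\<^esub> \<epsilon> \<alpha> \<otimes>\<^bsub>A\<^esub> b) (\<beta> \<otimes>\<^bsub>B\<^esub> \<gamma>) c
      \<oplus>\<^bsub>HH\<^esub> hc_class (c \<otimes>\<^bsub>A\<^esub> \<epsilon> \<beta> \<otimes>\<^bsub>A\<^esub> a) (\<alpha> \<otimes>\<^bsub>B\<^esub> \<gamma>) b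
    = hc_class a (\<alpha> \<otimes>\<^bsub>B\<^esub> \<beta>) (b \<otimes>\<^bsub>A\<^esub> \<epsilon> \<gamma> \<otimes>\<^bsub>A\<^esub> c)" (is "?x \<oplus>\<^bsub>HH\<^esub> ?z = ?y")
proof -
  have m: "mt3 a \<alpha> \<beta> b \<gamma> c \<in> carrier CC2"
    using C2_spans[OF modA modB] assms unfolding spans_def by blast
  have "cls1 (hoch a \<alpha> \<beta> b \<gamma> c) \<in> Bdry"
    unfolding Bdry_def using m assms by (intro image_eqI[OF _ m]) (simp add: bd2_mat3)
  moreover have "hoch a \<alpha> \<beta> b \<gamma> c \<in> carrier CC1" using assms by (simp add: hoch_def)
  ultimately have "Bdry +>\<^bsub>CQ1\<^esub> (cls1 (hoch a \<alpha> \<beta> b \<gamma> c)) = \<zero>\<^bsub>HH\<^esub>"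
    by (simp add: HC1_eq quot_zero_iff[OF CQ1_mod Bdry_sub] mod_hom_closed[OF cls1_hom])
  then have "(?x \<ominus>\<^bsub>HH\<^esub> ?y) \<oplus>\<^bsub>HH\<^esub> ?z = \<zero>\<^bsub>HH\<^esub>"
    unfolding hoch_def hc_class_def using assms
    by (simp add: mod_hom_add[OF HC1_proj_hom] mod_hom_minus[OF C1_mod HC1_mod HC1_proj_hom])
  then have "(?x \<oplus>\<^bsub>HH\<^esub> ?z) \<ominus>\<^bsub>HH\<^esub> ?y = \<zero>\<^bsub>HH\<^esub>"
    using assms by (simp add: a_minus_def H.M.a_ac)
  then show ?thesis
    using assms by (subst (asm) H.M.diff_eq_zero_iff) auto
qed

text \<open>The universal property of \<open>HC1\<close>. A trilinear map extends to
  \<open>CC1\<close>; antisymmetry lets it factor through the cyclic quotient, and the relation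
  \<open>hex\<close> through the quotient by boundaries.\<close>

lemma HC1_lift_exists:
  fixes P :: "('k, 'p, 'u) module_scheme"
  assumes P: "module K P" and tri: "trilin K A A B P (\<lambda>a b \<alpha>. f a \<alpha> b)"
    and anti: "\<And>a \<alpha> b. a \<in> carrier A \<Longrightarrow> \<alpha> \<in> carrier B \<Longrightarrow> b \<in> carrier A
      \<Longrightarrow> f a \<alpha> b \<oplus>\<^bsub>P\<^esub> f b \<alpha> a = \<zero>\<^bsub>P\<^esub>"
    and hex: "\<And>a \<alpha> \<beta> b \<gamma> c. a \<in> carrier A \<Longrightarrow> \<alpha> \<in> carrier B \<Longrightarrow> \<beta> \<in> carrier B \<Longrightarrow> b \<in> carrier A
      \<Longrightarrow> \<gamma> \<in> carrier B \<Longrightarrow> c \<in> carrier A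
      \<Longrightarrow> f (a \<otimes>\<^bsub>A\<^esub> \<epsilon> \<alpha> \<otimes>\<^bsub>A\<^esub> b) (\<beta> \<otimes>\<^bsub>B\<^esub> \<gamma>) c
          \<oplus>\<^bsub>P\<^esub> f (c \<otimes>\<^bsub>A\<^esub> \<epsilon> \<beta> \<otimes>\<^bsub>A\<^esub> a) (\<alpha> \<otimes>\<^bsub>B\<^esub> \<gamma>) b
        = f a (\<alpha> \<otimes>\<^bsub>B\<^esub> \<beta>) (b \<otimes>\<^bsub>A\<^esub> \<epsilon> \<gamma> \<otimes>\<^bsub>A\<^esub> c)"
  obtains h where "h \<in> mod_hom K HH P"
    and "\<And>a \<alpha> b. a \<in> carrier A \<Longrightarrow> \<alpha> \<in> carrier B \<Longrightarrow> b \<in> carrier A \<Longrightarrow> h (hc_class a \<alpha> b) = f a \<alpha> b"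
proof -
  interpret P: module K P by fact
  obtain h1 where h1: "h1 \<in> mod_hom K CC1 P"
    and v1: "\<And>a \<alpha> b. a \<in> carrier A \<Longrightarrow> \<alpha> \<in> carrier B \<Longrightarrow> b \<in> carrier A \<Longrightarrow> h1 (mt2 a \<alpha> b) = f a \<alpha> b"
    using C1_lift_exists[OF modA modB P tri] by blast
  have fc: "f a \<alpha> b \<in> carrier P" if "a \<in> carrier A" "\<alpha> \<in> carrier B" "b \<in> carrier A" for a \<alpha> b
    using that mod_hom_closed[OF h1, of "mt2 a \<alpha> b"] by (simp add: v1)
  \<comment> \<open>Antisymmetry of f says precisely that the extension is invariant under
    \<lambda>.\<close>
  have inv: "h1 (cyc1 K A B x) = h1 x" if "x \<in> carrier CC1" for x
  proof (rule spans_hom_eq[OF C1_mod P C1_spans[OF modA modB] mod_hom_comp[OF cyc1_hom h1] h1 _ that])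
    fix x assume "x \<in> {mt2 a \<alpha> b | a \<alpha> b. a \<in> carrier A \<and> \<alpha> \<in> carrier B \<and> b \<in> carrier A}"
    then obtain a \<alpha> b where "x = mt2 a \<alpha> b" "a \<in> carrier A" "\<alpha> \<in> carrier B" "b \<in> carrier A" by auto
    then show "h1 (cyc1 K A B x) = h1 x"
      using P.M.minus_equality[OF anti] by (simp add: cyc1_mat2 mod_hom_uminus[OF C1_mod P h1] v1 fc)
  qed
  have z1: "h1 x = \<zero>\<^bsub>P\<^esub>" if "x \<in> N1" for x
    using that mod_hom_closed[OF cyc1_hom] mod_hom_closed[OF h1]
    by (auto simp: im_one_minus_def mod_hom_minus[OF C1_mod P h1] inv P.M.diff_eq_zero_iff)
  note h2 = quot_lift_hom[OF C1_mod N1_sub P h1 z1] and v2 = quot_lift_coset[OF C1_mod N1_sub P h1 z1]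
  have hb: "h1 (bd2 K A B \<epsilon> x) = \<zero>\<^bsub>P\<^esub>" if "x \<in> carrier CC2" for x
  proof (rule spans_hom_eq[OF C2_mod P C2_spans[OF modA modB] mod_hom_comp[OF bd2_hom h1] zero_hom[OF P] _ that])
    fix y assume "y \<in> {mt3 a \<alpha> \<beta> b \<gamma> c | a \<alpha> \<beta> b \<gamma> c. a \<in> carrier A \<and> \<alpha> \<in> carrier B \<and> \<beta> \<in> carrier B
      \<and> b \<in> carrier A \<and> \<gamma> \<in> carrier B \<and> c \<in> carrier A}"
    then obtain a \<alpha> \<beta> b \<gamma> c where y: "y = mt3 a \<alpha> \<beta> b \<gamma> c" and
      c: "a \<in> carrier A" "\<alpha> \<in> carrier B" "\<beta> \<in> carrier B" "b \<in> carrier A" "\<gamma> \<in> carrier B" "c \<in> carrier A"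
      by auto
    let ?x = "f (a \<otimes>\<^bsub>A\<^esub> \<epsilon> \<alpha> \<otimes>\<^bsub>A\<^esub> b) (\<beta> \<otimes>\<^bsub>B\<^esub> \<gamma>) c"
    let ?z = "f (c \<otimes>\<^bsub>A\<^esub> \<epsilon> \<beta> \<otimes>\<^bsub>A\<^esub> a) (\<alpha> \<otimes>\<^bsub>B\<^esub> \<gamma>) b"
    let ?y = "f a (\<alpha> \<otimes>\<^bsub>B\<^esub> \<beta>) (b \<otimes>\<^bsub>A\<^esub> \<epsilon> \<gamma> \<otimes>\<^bsub>A\<^esub> c)"
    have "(?x \<ominus>\<^bsub>P\<^esub> ?y) \<oplus>\<^bsub>P\<^esub> ?z = (?x \<oplus>\<^bsub>P\<^esub> ?z) \<ominus>\<^bsub>P\<^esub> ?y"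
      using c fc by (simp add: a_minus_def P.M.a_ac)
    also have "\<dots> = \<zero>\<^bsub>P\<^esub>" using c fc by (simp add: hex P.M.diff_eq_zero_iff)
    finally show "h1 (bd2 K A B \<epsilon> y) = \<zero>\<^bsub>P\<^esub>"
      using c by (simp add: y bd2_mat3 hoch_def mod_hom_add[OF h1] mod_hom_minus[OF C1_mod P h1] v1)
  qed
  have z2: "quot_lift h1 x = \<zero>\<^bsub>P\<^esub>" if "x \<in> Bdry" for x
    using that by (auto simp: Bdry_def v2 mod_hom_closed[OF bd2_hom] hb)
  show ?thesis
  proof (rule that)
    show "quot_lift (quot_lift h1) \<in> mod_hom K HH P"
      unfolding HC1_eq by (rule quot_lift_hom[OF CQ1_mod Bdry_sub P h2 z2])
    fix a \<alpha> b assume "a \<in> carrier A" "\<alpha> \<in> carrier B" "b \<in> carrier A"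
    then show "quot_lift (quot_lift h1) (hc_class a \<alpha> b) = f a \<alpha> b"
      unfolding hc_class_def
      by (simp add: quot_lift_coset[OF CQ1_mod Bdry_sub P h2 z2] mod_hom_closed[OF cls1_hom] v2 v1)
  qed
qed

end

section \<open>Secondary differentials modulo exact ones\<close>

lemma restrict_scalars_simps [simp]:
  "carrier (restrict_scalars A M) = carrier M"
  "add (restrict_scalars A M) = add M"
  "zero (restrict_scalars A M) = zero M"
  "smult (restrict_scalars A M) r x = (r \<odot>\<^bsub>A\<^esub> \<one>\<^bsub>A\<^esub>) \<odot>\<^bsub>M\<^esub> x"
  by (simp_all add: restrict_scalars_def)

lemma restrict_scalars_module:
  assumes A: "algebra K A" and M: "module A M"
  shows "module K (restrict_scalars A M)"
proof -
  interpret Ar: cring A by (rule algebra.M_cring[OF A])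
  interpret A: algebra K A by fact
  interpret M: module A M by fact
  show ?thesis
  proof (rule moduleI)
    show "cring K" by (rule A.R_cring)
    show "abelian_group (restrict_scalars A M)"
    proof (rule abelian_groupI)
      fix x assume "x \<in> carrier (restrict_scalars A M)"
      then show "\<exists>y \<in> carrier (restrict_scalars A M).
          y \<oplus>\<^bsub>restrict_scalars A M\<^esub> x = \<zero>\<^bsub>restrict_scalars A M\<^esub>"
        by (intro bexI[of _ "\<ominus>\<^bsub>M\<^esub> x"]) (auto simp: M.M.l_neg)
    qed (auto simp: M.M.a_ac)
  next
    fix r s x assume "r \<in> carrier K" "s \<in> carrier K" "x \<in> carrier (restrict_scalars A M)"
    then show "(r \<otimes>\<^bsub>K\<^esub> s) \<odot>\<^bsub>restrict_scalars A M\<^esub> x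
        = r \<odot>\<^bsub>restrict_scalars A M\<^esub> (s \<odot>\<^bsub>restrict_scalars A M\<^esub> x)"
      by (simp add: M.smult_assoc1[symmetric] A.smult_assoc2 A.smult_assoc1)
  qed (auto simp: A.smult_l_distr M.smult_l_distr M.smult_r_distr)
qed

text \<open>A scalar r acts as the element r 1 of \<open>A\<close>, so closure under
  \<open>A\<close> includes closure under \<open>K\<close>.\<close>

lemma restrict_scalars_submodule:
  assumes A: "algebra K A" and M: "module A M" and N: "submodule N A M"
  shows "submodule N K (restrict_scalars A M)"
proof -
  interpret Ar: cring A by (rule algebra.M_cring[OF A])
  interpret A: algebra K A by fact
  interpret M: module A M by fact
  interpret RS: module K "restrict_scalars A M" by (rule restrict_scalars_module[OF A M])
  have inv: "\<ominus>\<^bsub>restrict_scalars A M\<^esub> x = \<ominus>\<^bsub>M\<^esub> x" if "x \<in> carrier M" for x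
    using that by (intro RS.M.minus_equality) (auto simp: M.M.l_neg)
  show ?thesis
  proof (rule RS.submoduleI)
    show "\<zero>\<^bsub>restrict_scalars A M\<^esub> \<in> N"
      using subgroup.one_closed[OF submodule.axioms(1)[OF N]] by simp
  qed (use M.submoduleE[OF N] inv in auto)
qed

text \<open>An equality of records, not just an isomorphism: the cosets depend only on the additive
  structure. Hence the restricted module of differentials is literally a quotient of the restricted
  free module.\<close>

lemma restrict_scalars_quot:
  "restrict_scalars A (quot_module M N) = quot_module (restrict_scalars A M) N"
proof -
  have "set_add (restrict_scalars A M) = set_add M"
    by (intro ext) (simp add: set_add_def')
  then show ?thesis
    by (simp add: restrict_scalars_def quot_module_def A_RCOSETS_def' a_r_coset_def')
qed

section \<open>Differentials as a \<open>K\<close>-module and their quotient by exact forms\<close>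

context commutative_triple
begin

abbreviation "T \<equiv> tensor K B A"
abbreviation "t \<equiv> tens K B A"
abbreviation "FA \<equiv> kaehler_free K A B"
abbreviation "FK \<equiv> restrict_scalars A FA"
abbreviation "g \<equiv> free_gen A"
abbreviation "RA \<equiv> generated_submodule A FA (kaehler_rels K A B \<epsilon>)"
abbreviation "OmK \<equiv> restrict_scalars A (Omega K A B \<epsilon>)"
abbreviation "Exact \<equiv> exact_differentials K A B \<epsilon>"
abbreviation "OmQ \<equiv> quot_module OmK Exact"

lemmas T_mod = tensor_module[OF modB modA]
sublocale T: module K T by (rule T_mod)

lemma t_closed [simp]: "\<alpha> \<in> carrier B \<Longrightarrow> a \<in> carrier A \<Longrightarrow> t \<alpha> a \<in> carrier T"
  by (rule tens_closed[OF modB modA])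

lemma FA_mod: "module A FA"
  unfolding kaehler_free_def by (rule free_module_module[OF Ar.is_cring])

sublocale FA: module A FA by (rule FA_mod)

lemmas FK_mod = restrict_scalars_module[OF algA FA_mod]

lemma g_closed [simp]: "x \<in> carrier T \<Longrightarrow> g x \<in> carrier FA"
  unfolding kaehler_free_def by (rule free_gen_closed[OF Ar.is_cring])

lemma kaehler_rels_sub: "kaehler_rels K A B \<epsilon> \<subseteq> carrier FA"
  unfolding kaehler_rels_def Let_def
  by (auto intro!: FA.M.minus_closed FA.M.a_closed FA.smult_closed g_closed t_closed
      T.M.a_closed T.smult_closed A.smult_closed Ar.m_closed Br.m_closed)

lemmas RA_sub = generated_submodule_submodule[OF FA_mod kaehler_rels_sub]
lemmas RA_subK = restrict_scalars_submodule[OF algA FA_mod RA_sub]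

lemma OmK_eq: "OmK = quot_module FK RA"
  unfolding Omega_def by (rule restrict_scalars_quot)

lemma OmK_mod: "module K OmK"
  unfolding OmK_eq by (rule quot_module_module[OF FK_mod RA_subK])

sublocale OmK: module K OmK by (rule OmK_mod)

abbreviation "clsO f \<equiv> RA +>\<^bsub>FA\<^esub> f"

lemma clsO_K: "RA +>\<^bsub>FK\<^esub> f = clsO f"
  by (simp add: a_r_coset_def')

lemma clsO_hom: "(\<lambda>f. clsO f) \<in> mod_hom K FK OmK"
  using quot_proj_hom[OF FK_mod RA_subK] unfolding OmK_eq clsO_K .

lemma smult_g_hom:
  assumes "x \<in> carrier T"
  shows "(\<lambda>a. a \<odot>\<^bsub>FA\<^esub> g x) \<in> mod_hom K A FK"
proof (rule mod_homI)
  fix r a assume "r \<in> carrier K" "a \<in> carrier A"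
  then show "(r \<odot>\<^bsub>A\<^esub> a) \<odot>\<^bsub>FA\<^esub> g x = r \<odot>\<^bsub>FK\<^esub> (a \<odot>\<^bsub>FA\<^esub> g x)"
    using assms by (simp add: FA.smult_assoc1[symmetric] A.smult_assoc2)
qed (use assms in \<open>auto simp: FA.smult_l_distr\<close>)

text \<open>\<open>RA\<close> is generated over \<open>A\<close>, so a relation survives
  multiplication by any c. The multiple is recorded here because only the \<open>K\<close>-action is
  kept on \<open>OmK\<close>.\<close>

lemma clsO_eqI:
  assumes "u \<in> carrier FA" "v \<in> carrier FA" "c \<in> carrier A" "u \<ominus>\<^bsub>FA\<^esub> v \<in> kaehler_rels K A B \<epsilon>"
  shows "clsO (c \<odot>\<^bsub>FA\<^esub> u) = clsO (c \<odot>\<^bsub>FA\<^esub> v)"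
proof -
  have "u \<ominus>\<^bsub>FA\<^esub> v \<in> RA" by (rule subsetD[OF generated_submodule_incl assms(4)])
  then have "c \<odot>\<^bsub>FA\<^esub> (u \<ominus>\<^bsub>FA\<^esub> v) \<in> RA" by (rule submodule.smult_closed[OF RA_sub assms(3)])
  then show ?thesis
    using assms by (simp add: quot_eq_iff[OF FA_mod RA_sub] a_minus_def FA.smult_r_distr FA.smult_r_minus)
qed

lemma clsO_lin_rel:
  assumes "c \<in> carrier A" "r \<in> carrier K" "s \<in> carrier K" "x \<in> carrier T" "y \<in> carrier T"
  shows "clsO (c \<odot>\<^bsub>FA\<^esub> g (r \<odot>\<^bsub>T\<^esub> x \<oplus>\<^bsub>T\<^esub> s \<odot>\<^bsub>T\<^esub> y))
    = r \<odot>\<^bsub>OmK\<^esub> clsO (c \<odot>\<^bsub>FA\<^esub> g x) \<oplus>\<^bsub>OmK\<^esub> s \<odot>\<^bsub>OmK\<^esub> clsO (c \<odot>\<^bsub>FA\<^esub> g y)"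
proof -
  let ?r = "r \<odot>\<^bsub>A\<^esub> \<one>\<^bsub>A\<^esub>" and ?s = "s \<odot>\<^bsub>A\<^esub> \<one>\<^bsub>A\<^esub>"
  have "clsO (c \<odot>\<^bsub>FA\<^esub> g (r \<odot>\<^bsub>T\<^esub> x \<oplus>\<^bsub>T\<^esub> s \<odot>\<^bsub>T\<^esub> y))
      = clsO (c \<odot>\<^bsub>FA\<^esub> (?r \<odot>\<^bsub>FA\<^esub> g x \<oplus>\<^bsub>FA\<^esub> ?s \<odot>\<^bsub>FA\<^esub> g y))"
    by (rule clsO_eqI) (use assms in \<open>auto simp: kaehler_rels_def Let_def\<close>)
  also have "c \<odot>\<^bsub>FA\<^esub> (?r \<odot>\<^bsub>FA\<^esub> g x \<oplus>\<^bsub>FA\<^esub> ?s \<odot>\<^bsub>FA\<^esub> g y)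
      = r \<odot>\<^bsub>FK\<^esub> (c \<odot>\<^bsub>FA\<^esub> g x) \<oplus>\<^bsub>FK\<^esub> s \<odot>\<^bsub>FK\<^esub> (c \<odot>\<^bsub>FA\<^esub> g y)"
    using assms by (simp add: FA.smult_r_distr FA.smult_assoc1[symmetric] Ar.m_comm)
  also have "clsO \<dots> = r \<odot>\<^bsub>OmK\<^esub> clsO (c \<odot>\<^bsub>FA\<^esub> g x) \<oplus>\<^bsub>OmK\<^esub> s \<odot>\<^bsub>OmK\<^esub> clsO (c \<odot>\<^bsub>FA\<^esub> g y)"
    using assms module.smult_closed[OF FK_mod]
    by (subst mod_hom_add[OF clsO_hom] mod_hom_smult[OF clsO_hom]; simp del: restrict_scalars_simps(4))+
  finally show ?thesis .
qed

text \<open>Relation (i) contains both laws: the coefficients 1, 1 give additivity and r, 0 give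
  homogeneity.\<close>

lemma clsO_g_hom:
  assumes c: "c \<in> carrier A"
  shows "(\<lambda>x. clsO (c \<odot>\<^bsub>FA\<^esub> g x)) \<in> mod_hom K T OmK"
proof -
  have cl: "clsO (c \<odot>\<^bsub>FA\<^esub> g x) \<in> carrier OmK" if "x \<in> carrier T" for x
    by (rule mod_hom_closed[OF clsO_hom]) (use c that in simp)
  show ?thesis
  proof (rule mod_homI)
    fix x y assume "x \<in> carrier T" "y \<in> carrier T"
    then show "clsO (c \<odot>\<^bsub>FA\<^esub> g (x \<oplus>\<^bsub>T\<^esub> y)) = clsO (c \<odot>\<^bsub>FA\<^esub> g x) \<oplus>\<^bsub>OmK\<^esub> clsO (c \<odot>\<^bsub>FA\<^esub> g y)"
      using clsO_lin_rel[OF c, of "\<one>\<^bsub>K\<^esub>" "\<one>\<^bsub>K\<^esub>" x y] cl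
      by (simp del: restrict_scalars_simps)
  next
    fix r x assume "r \<in> carrier K" "x \<in> carrier T"
    then show "clsO (c \<odot>\<^bsub>FA\<^esub> g (r \<odot>\<^bsub>T\<^esub> x)) = r \<odot>\<^bsub>OmK\<^esub> clsO (c \<odot>\<^bsub>FA\<^esub> g x)"
      using clsO_lin_rel[OF c, of r "\<zero>\<^bsub>K\<^esub>" x x] cl
      by (simp del: restrict_scalars_simps)
  qed (rule cl)
qed

text \<open>The factor 1 brings exact forms into the general shape c d(x), so that statements about
  that shape apply with c = 1.\<close>

lemma Exact_eq: "Exact = (\<lambda>a. clsO (\<one>\<^bsub>A\<^esub> \<odot>\<^bsub>FA\<^esub> g (t \<one>\<^bsub>B\<^esub> a))) ` carrier A"
  unfolding exact_differentials_def kaehler_d_def by auto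

lemma t_hom:
  "f \<in> mod_hom K Q B \<Longrightarrow> a \<in> carrier A \<Longrightarrow> (\<lambda>q. t (f q) a) \<in> mod_hom K Q T"
  "\<alpha> \<in> carrier B \<Longrightarrow> h \<in> mod_hom K Q A \<Longrightarrow> (\<lambda>q. t \<alpha> (h q)) \<in> mod_hom K Q T"
  using tens_bilin[OF modB modA] mod_hom_comp[of f K Q B "\<lambda>\<alpha>. t \<alpha> a" T]
    mod_hom_comp[of h K Q A "\<lambda>a. t \<alpha> a" T]
  by (simp_all add: bilin_def)

text \<open>The image of the \<open>K\<close>-linear map sending a to d(1 \<otimes> a). A multiple c
  d(1 \<otimes> a) need not be exact, which is why the quotient is formed over
  \<open>K\<close>.\<close>

lemma Exact_sub: "submodule Exact K OmK"
  unfolding Exact_eq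
  by (rule submodule_image[OF modA OmK_mod mod_hom_comp[OF t_hom(2)[OF _ mod_hom_id] clsO_g_hom] module.carrier_is_submodule[OF modA]])
    auto

lemma OmQ_mod: "module K OmQ"
  by (rule quot_module_module[OF OmK_mod Exact_sub])

sublocale OmQ: module K OmQ by (rule OmQ_mod)

lemmas OmQ_proj_hom = quot_proj_hom[OF OmK_mod Exact_sub]
lemmas FQ_proj_hom = mod_hom_comp[OF clsO_hom OmQ_proj_hom]

text \<open>The class of a d(x) modulo exact forms. The coefficient is an argument because
  \<open>OmQ\<close> offers no multiplication by elements of \<open>A\<close>.\<close>

definition dform where "dform a x = Exact +>\<^bsub>OmK\<^esub> (clsO (a \<odot>\<^bsub>FA\<^esub> g x))"

lemma dform_hom:
  "x \<in> carrier T \<Longrightarrow> (\<lambda>a. dform a x) \<in> mod_hom K A OmQ"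
  "a \<in> carrier A \<Longrightarrow> (\<lambda>x. dform a x) \<in> mod_hom K T OmQ"
  unfolding dform_def
  by (rule mod_hom_comp[OF smult_g_hom FQ_proj_hom], assumption)
    (rule mod_hom_comp[OF clsO_g_hom OmQ_proj_hom], assumption)

lemma dform_closed [simp]: "a \<in> carrier A \<Longrightarrow> x \<in> carrier T \<Longrightarrow> dform a x \<in> carrier OmQ"
  by (rule mod_hom_closed[OF dform_hom(1)])

lemma dform_add2:
  assumes "c \<in> carrier A" "a \<in> carrier A" "b \<in> carrier A" "x \<in> carrier T" "y \<in> carrier T"
  shows "Exact +>\<^bsub>OmK\<^esub> (clsO (c \<odot>\<^bsub>FA\<^esub> (a \<odot>\<^bsub>FA\<^esub> g x \<oplus>\<^bsub>FA\<^esub> b \<odot>\<^bsub>FA\<^esub> g y)))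
    = dform (c \<otimes>\<^bsub>A\<^esub> a) x \<oplus>\<^bsub>OmQ\<^esub> dform (c \<otimes>\<^bsub>A\<^esub> b) y"
  using assms mod_hom_add[OF FQ_proj_hom, of "(c \<otimes>\<^bsub>A\<^esub> a) \<odot>\<^bsub>FA\<^esub> g x" "(c \<otimes>\<^bsub>A\<^esub> b) \<odot>\<^bsub>FA\<^esub> g y"]
  by (simp add: dform_def FA.smult_r_distr FA.smult_assoc1)

lemma dform_leibniz:
  assumes "c \<in> carrier A" "\<alpha> \<in> carrier B" "\<beta> \<in> carrier B" "a \<in> carrier A" "b \<in> carrier A"
  shows "dform c (t (\<alpha> \<otimes>\<^bsub>B\<^esub> \<beta>) (a \<otimes>\<^bsub>A\<^esub> b))
    = dform (c \<otimes>\<^bsub>A\<^esub> (a \<otimes>\<^bsub>A\<^esub> \<epsilon> \<alpha>)) (t \<beta> b) \<oplus>\<^bsub>OmQ\<^esub> dform (c \<otimes>\<^bsub>A\<^esub> (b \<otimes>\<^bsub>A\<^esub> \<epsilon> \<beta>)) (t \<alpha> a)"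
proof -
  have "clsO (c \<odot>\<^bsub>FA\<^esub> g (t (\<alpha> \<otimes>\<^bsub>B\<^esub> \<beta>) (a \<otimes>\<^bsub>A\<^esub> b)))
      = clsO (c \<odot>\<^bsub>FA\<^esub> ((a \<otimes>\<^bsub>A\<^esub> \<epsilon> \<alpha>) \<odot>\<^bsub>FA\<^esub> g (t \<beta> b) \<oplus>\<^bsub>FA\<^esub> (b \<otimes>\<^bsub>A\<^esub> \<epsilon> \<beta>) \<odot>\<^bsub>FA\<^esub> g (t \<alpha> a)))"
    by (rule clsO_eqI) (use assms in \<open>auto simp: kaehler_rels_def Let_def\<close>)
  then show ?thesis
    using assms by (simp add: dform_add2[symmetric]) (simp add: dform_def)
qed

lemma dform_half:
  assumes "c \<in> carrier A" "\<alpha> \<in> carrier B"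
  shows "dform c (t \<alpha> \<one>\<^bsub>A\<^esub>) \<oplus>\<^bsub>OmQ\<^esub> dform c (t \<alpha> \<one>\<^bsub>A\<^esub>) = dform c (t \<one>\<^bsub>B\<^esub> (\<epsilon> \<alpha>))"
proof -
  have "clsO (c \<odot>\<^bsub>FA\<^esub> (g (t \<alpha> \<one>\<^bsub>A\<^esub>) \<oplus>\<^bsub>FA\<^esub> g (t \<alpha> \<one>\<^bsub>A\<^esub>))) = clsO (c \<odot>\<^bsub>FA\<^esub> g (t \<one>\<^bsub>B\<^esub> (\<epsilon> \<alpha>)))"
    by (rule clsO_eqI) (use assms in \<open>auto simp: kaehler_rels_def Let_def\<close>)
  then show ?thesis
    using assms dform_add2[of c "\<one>\<^bsub>A\<^esub>" "\<one>\<^bsub>A\<^esub>" "t \<alpha> \<one>\<^bsub>A\<^esub>" "t \<alpha> \<one>\<^bsub>A\<^esub>"] by (simp add: dform_def)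
qed

lemma dform_exact:
  assumes "a \<in> carrier A"
  shows "dform \<one>\<^bsub>A\<^esub> (t \<one>\<^bsub>B\<^esub> a) = \<zero>\<^bsub>OmQ\<^esub>"
proof -
  have m: "clsO (\<one>\<^bsub>A\<^esub> \<odot>\<^bsub>FA\<^esub> g (t \<one>\<^bsub>B\<^esub> a)) \<in> Exact"
    unfolding Exact_eq using assms by (rule imageI)
  then have "clsO (\<one>\<^bsub>A\<^esub> \<odot>\<^bsub>FA\<^esub> g (t \<one>\<^bsub>B\<^esub> a)) \<in> carrier OmK"
    by (rule subsetD[OF OmK.submoduleE(1)[OF Exact_sub]])
  with m show ?thesis
    unfolding dform_def by (simp only: quot_zero_iff[OF OmK_mod Exact_sub])
qed

text \<open>Over \<open>K\<close> the basis elements alone no longer suffice; their multiples by all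
  elements of \<open>A\<close> are needed.\<close>

lemma FK_spans: "spans K FK {a \<odot>\<^bsub>FA\<^esub> g x | a x. a \<in> carrier A \<and> x \<in> carrier T}"
  unfolding spans_def
proof (intro conjI allI impI)
  interpret FK: module K FK by (rule FK_mod)
  show "{a \<odot>\<^bsub>FA\<^esub> g x | a x. a \<in> carrier A \<and> x \<in> carrier T} \<subseteq> carrier FK" by auto
  fix N assume N: "submodule N K FK" and sub: "{a \<odot>\<^bsub>FA\<^esub> g x | a x. a \<in> carrier A \<and> x \<in> carrier T} \<subseteq> N"
  show "carrier FK \<subseteq> N"
  proof
    fix f assume "f \<in> carrier FK"
    then have f: "f \<in> carrier (free_module A (carrier T))" by (simp add: kaehler_free_def)
    show "f \<in> N"
    proof (rule free_module_induct[OF Ar.is_cring f, where Q = "\<lambda>f. f \<in> N"], fold kaehler_free_def)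
      show "\<zero>\<^bsub>FA\<^esub> \<in> N"
        using subgroup.one_closed[OF submodule.axioms(1)[OF N]] by simp
      show "f \<oplus>\<^bsub>FA\<^esub> f' \<in> N" if "f \<in> N" "f' \<in> N" for f f'
        using FK.submoduleE(5)[OF N that] by simp
    qed (use sub in blast)
  qed
qed

text \<open>The presentation has a symbol d(x) for every x in the tensor product. Linearity in x
  cuts these down to elementary tensors, matching the generators of \<open>HC1\<close>.\<close>

lemma OmQ_spans: "spans K OmQ
    {dform a (t \<alpha> b) | a \<alpha> b. a \<in> carrier A \<and> \<alpha> \<in> carrier B \<and> b \<in> carrier A}"
proof -
  have "spans K OmK ((\<lambda>f. clsO f) ` {a \<odot>\<^bsub>FA\<^esub> g x | a x. a \<in> carrier A \<and> x \<in> carrier T})"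
    using quot_spans[OF FK_mod RA_subK FK_spans] unfolding OmK_eq clsO_K .
  then have "spans K OmQ ((\<lambda>f. Exact +>\<^bsub>OmK\<^esub> f) ` (\<lambda>f. clsO f) ` {a \<odot>\<^bsub>FA\<^esub> g x | a x. a \<in> carrier A \<and> x \<in> carrier T})"
    by (rule quot_spans[OF OmK_mod Exact_sub])
  then have "spans K OmQ {dform a x | a x. a \<in> carrier A \<and> x \<in> carrier T}"
    unfolding dform_def by (rule spans_cong) blast
  then show ?thesis
  proof (rule spans_trans)
    fix N assume N: "submodule N K OmQ"
      and sub: "{dform a (t \<alpha> b) | a \<alpha> b. a \<in> carrier A \<and> \<alpha> \<in> carrier B \<and> b \<in> carrier A} \<subseteq> N"
    have "dform a x \<in> N" if "a \<in> carrier A" "x \<in> carrier T" for a x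
      by (rule spans_hom_into[OF T_mod OmQ_mod tensor_spans[OF modB modA] dform_hom(2)[OF that(1)] N _ that(2)])
        (use sub that(1) in blast)
    then show "{dform a x | a x. a \<in> carrier A \<and> x \<in> carrier T} \<subseteq> N" by blast
  qed auto
qed

text \<open>The universal property of the quotient, for targets that are only
  \<open>K\<close>-modules. Think of \<open>f c x\<close> as the intended value at c d(x): without
  an \<open>A\<close>-action on the target, the Leibniz and halving rules must be demanded for every
  coefficient c.\<close>

lemma OmQ_lift_exists:
  fixes P :: "('k, 'p, 'u) module_scheme"
  assumes P: "module K P" and bil: "bilin K A T P f"
    and leibniz: "\<And>c \<alpha> \<beta> a b. c \<in> carrier A \<Longrightarrow> \<alpha> \<in> carrier B \<Longrightarrow> \<beta> \<in> carrier B \<Longrightarrow> a \<in> carrier A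
      \<Longrightarrow> b \<in> carrier A \<Longrightarrow> f c (t (\<alpha> \<otimes>\<^bsub>B\<^esub> \<beta>) (a \<otimes>\<^bsub>A\<^esub> b))
        = f (c \<otimes>\<^bsub>A\<^esub> (a \<otimes>\<^bsub>A\<^esub> \<epsilon> \<alpha>)) (t \<beta> b) \<oplus>\<^bsub>P\<^esub> f (c \<otimes>\<^bsub>A\<^esub> (b \<otimes>\<^bsub>A\<^esub> \<epsilon> \<beta>)) (t \<alpha> a)"
    and half: "\<And>c \<alpha>. c \<in> carrier A \<Longrightarrow> \<alpha> \<in> carrier B
      \<Longrightarrow> f c (t \<alpha> \<one>\<^bsub>A\<^esub>) \<oplus>\<^bsub>P\<^esub> f c (t \<alpha> \<one>\<^bsub>A\<^esub>) = f c (t \<one>\<^bsub>B\<^esub> (\<epsilon> \<alpha>))"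
    and exact: "\<And>a. a \<in> carrier A \<Longrightarrow> f \<one>\<^bsub>A\<^esub> (t \<one>\<^bsub>B\<^esub> a) = \<zero>\<^bsub>P\<^esub>"
  obtains h where "h \<in> mod_hom K OmQ P"
    and "\<And>a x. a \<in> carrier A \<Longrightarrow> x \<in> carrier T \<Longrightarrow> h (dform a x) = f a x"
proof -
  interpret P: module K P by fact
  note fD = bilinD[OF modA T_mod P bil]
  \<comment> \<open>Here coefficients lie in \<open>A\<close> while the target is a
    \<open>K\<close>-module, so the summand depends on its coefficient only through the
    \<open>K\<close>-linear map f.\<close>
  define L where "L = free_lift A P (\<lambda>x a. f a x)"
  have Lg: "L (a \<odot>\<^bsub>FA\<^esub> g x) = f a x" if "a \<in> carrier A" "x \<in> carrier T" for a x
    using that unfolding L_def kaehler_free_def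
    by (subst free_lift_gen[OF Ar.is_cring P.M.abelian_group_axioms]) (auto simp: fD)
  have Lc: "L u \<in> carrier P" if "u \<in> carrier FA" for u
    using that unfolding L_def kaehler_free_def
    by (rule free_lift_closed[OF Ar.is_cring P.M.abelian_group_axioms, rotated -1]) (auto simp: fD)
  have La: "L (u \<oplus>\<^bsub>FA\<^esub> v) = L u \<oplus>\<^bsub>P\<^esub> L v" if "u \<in> carrier FA" "v \<in> carrier FA" for u v
    using that unfolding L_def kaehler_free_def
    by (rule free_lift_add[OF Ar.is_cring P.M.abelian_group_axioms, rotated -2]) (auto simp: fD)
  have L0: "L \<zero>\<^bsub>FA\<^esub> = \<zero>\<^bsub>P\<^esub>"
    using La[of "\<zero>\<^bsub>FA\<^esub>" "\<zero>\<^bsub>FA\<^esub>"] Lc[of "\<zero>\<^bsub>FA\<^esub>"] by (simp add: P.M.add.l_cancel_one)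
  have Ls: "L ((r \<odot>\<^bsub>A\<^esub> \<one>\<^bsub>A\<^esub>) \<odot>\<^bsub>FA\<^esub> u) = r \<odot>\<^bsub>P\<^esub> L u" if r: "r \<in> carrier K" and u: "u \<in> carrier FA" for r u
  proof (rule free_module_induct[OF Ar.is_cring u[unfolded kaehler_free_def],
        where Q = "\<lambda>u. L ((r \<odot>\<^bsub>A\<^esub> \<one>\<^bsub>A\<^esub>) \<odot>\<^bsub>FA\<^esub> u) = r \<odot>\<^bsub>P\<^esub> L u"], fold kaehler_free_def)
    show "L ((r \<odot>\<^bsub>A\<^esub> \<one>\<^bsub>A\<^esub>) \<odot>\<^bsub>FA\<^esub> \<zero>\<^bsub>FA\<^esub>) = r \<odot>\<^bsub>P\<^esub> L \<zero>\<^bsub>FA\<^esub>"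
      using r by (simp add: L0)
  next
    fix a x assume "a \<in> carrier A" "x \<in> carrier T"
    then show "L ((r \<odot>\<^bsub>A\<^esub> \<one>\<^bsub>A\<^esub>) \<odot>\<^bsub>FA\<^esub> (a \<odot>\<^bsub>FA\<^esub> g x)) = r \<odot>\<^bsub>P\<^esub> L (a \<odot>\<^bsub>FA\<^esub> g x)"
      using r by (simp add: FA.smult_assoc1[symmetric] Lg A.smult_assoc2 fD)
  next
    fix u v assume "u \<in> carrier FA" "v \<in> carrier FA"
      "L ((r \<odot>\<^bsub>A\<^esub> \<one>\<^bsub>A\<^esub>) \<odot>\<^bsub>FA\<^esub> u) = r \<odot>\<^bsub>P\<^esub> L u" "L ((r \<odot>\<^bsub>A\<^esub> \<one>\<^bsub>A\<^esub>) \<odot>\<^bsub>FA\<^esub> v) = r \<odot>\<^bsub>P\<^esub> L v"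
    then show "L ((r \<odot>\<^bsub>A\<^esub> \<one>\<^bsub>A\<^esub>) \<odot>\<^bsub>FA\<^esub> (u \<oplus>\<^bsub>FA\<^esub> v)) = r \<odot>\<^bsub>P\<^esub> L (u \<oplus>\<^bsub>FA\<^esub> v)"
      using r by (simp add: FA.smult_r_distr La Lc P.smult_r_distr)
  qed
  have Lh: "L \<in> mod_hom K FK P" by (rule mod_homI) (simp_all add: Lc La Ls)
  \<comment> \<open>Subtraction is that of \<open>FA\<close>, whereas \<open>Lh\<close> speaks about
    \<open>FK\<close>; adding \<open>L v\<close> back needs additivity only.\<close>
  have Lm: "L (u \<ominus>\<^bsub>FA\<^esub> v) = \<zero>\<^bsub>P\<^esub>" if "u \<in> carrier FA" "v \<in> carrier FA" "L u = L v" for u v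
  proof -
    have "L (u \<ominus>\<^bsub>FA\<^esub> v) \<oplus>\<^bsub>P\<^esub> L v = L v"
      using that by (simp add: La[symmetric] a_minus_def FA.M.a_assoc FA.M.l_neg)
    then show ?thesis using that by (simp add: Lc P.M.add.r_cancel_one)
  qed
  let ?N = "{u \<in> carrier FA. \<forall>c \<in> carrier A. L (c \<odot>\<^bsub>FA\<^esub> u) = \<zero>\<^bsub>P\<^esub>}"
  \<comment> \<open>\<open>L\<close> is only \<open>K\<close>-linear, so its kernel need not be an \<open>A\<close>-submodule, but \<open>?N\<close> is.\<close>
  have Nsub: "submodule ?N A FA"
  proof (rule FA.submoduleI)
    fix u assume "u \<in> ?N"
    then show "\<ominus>\<^bsub>FA\<^esub> u \<in> ?N"
      using Lm[of "\<zero>\<^bsub>FA\<^esub>"] by (auto simp: FA.smult_r_minus L0 a_minus_def)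
  qed (auto simp: L0 FA.smult_r_distr La FA.smult_assoc1[symmetric])
  have rel: "u \<ominus>\<^bsub>FA\<^esub> v \<in> ?N"
    if "u \<in> carrier FA" "v \<in> carrier FA" "\<And>c. c \<in> carrier A \<Longrightarrow> L (c \<odot>\<^bsub>FA\<^esub> u) = L (c \<odot>\<^bsub>FA\<^esub> v)" for u v
    using that Lm[of "_ \<odot>\<^bsub>FA\<^esub> u" "_ \<odot>\<^bsub>FA\<^esub> v"]
    by (auto simp: a_minus_def FA.smult_r_distr FA.smult_r_minus)
  have L2: "L (c \<odot>\<^bsub>FA\<^esub> (a \<odot>\<^bsub>FA\<^esub> g x \<oplus>\<^bsub>FA\<^esub> b \<odot>\<^bsub>FA\<^esub> g y)) = f (c \<otimes>\<^bsub>A\<^esub> a) x \<oplus>\<^bsub>P\<^esub> f (c \<otimes>\<^bsub>A\<^esub> b) y"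
    if "c \<in> carrier A" "a \<in> carrier A" "b \<in> carrier A" "x \<in> carrier T" "y \<in> carrier T" for a b c x y
    using that by (simp add: FA.smult_r_distr La FA.smult_assoc1[symmetric] Lg)
  have "kaehler_rels K A B \<epsilon> \<subseteq> ?N"
    unfolding kaehler_rels_def Let_def
  proof (intro Un_least subsetI)
    fix u assume "u \<in> {g (r \<odot>\<^bsub>T\<^esub> x \<oplus>\<^bsub>T\<^esub> s \<odot>\<^bsub>T\<^esub> y)
          \<ominus>\<^bsub>FA\<^esub> ((r \<odot>\<^bsub>A\<^esub> \<one>\<^bsub>A\<^esub>) \<odot>\<^bsub>FA\<^esub> g x \<oplus>\<^bsub>FA\<^esub> (s \<odot>\<^bsub>A\<^esub> \<one>\<^bsub>A\<^esub>) \<odot>\<^bsub>FA\<^esub> g y) | r s x y.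
         r \<in> carrier K \<and> s \<in> carrier K \<and> x \<in> carrier T \<and> y \<in> carrier T}"
    then show "u \<in> ?N"
    proof (elim CollectE exE conjE, hypsubst, intro rel)
      fix r s x y c assume *: "r \<in> carrier K" "s \<in> carrier K" "x \<in> carrier T" "y \<in> carrier T" "c \<in> carrier A"
      \<comment> \<open>This turns the coefficients r 1 and s 1 of relation (i) back into scalars of
        \<open>K\<close>, which f respects in its first argument.\<close>
      have "c \<otimes>\<^bsub>A\<^esub> (r \<odot>\<^bsub>A\<^esub> \<one>\<^bsub>A\<^esub>) = r \<odot>\<^bsub>A\<^esub> c" if "r \<in> carrier K" for r
        using that * by (simp add: Ar.m_comm[of c] A.smult_assoc2)
      with * show "L (c \<odot>\<^bsub>FA\<^esub> g (r \<odot>\<^bsub>T\<^esub> x \<oplus>\<^bsub>T\<^esub> s \<odot>\<^bsub>T\<^esub> y))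
          = L (c \<odot>\<^bsub>FA\<^esub> ((r \<odot>\<^bsub>A\<^esub> \<one>\<^bsub>A\<^esub>) \<odot>\<^bsub>FA\<^esub> g x \<oplus>\<^bsub>FA\<^esub> (s \<odot>\<^bsub>A\<^esub> \<one>\<^bsub>A\<^esub>) \<odot>\<^bsub>FA\<^esub> g y))"
        by (simp add: L2 Lg fD)
    qed auto
  next
    fix u assume "u \<in> {g (t (\<alpha> \<otimes>\<^bsub>B\<^esub> \<beta>) (a \<otimes>\<^bsub>A\<^esub> b))
          \<ominus>\<^bsub>FA\<^esub> ((a \<otimes>\<^bsub>A\<^esub> \<epsilon> \<alpha>) \<odot>\<^bsub>FA\<^esub> g (t \<beta> b) \<oplus>\<^bsub>FA\<^esub> (b \<otimes>\<^bsub>A\<^esub> \<epsilon> \<beta>) \<odot>\<^bsub>FA\<^esub> g (t \<alpha> a)) | \<alpha> \<beta> a b.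
         \<alpha> \<in> carrier B \<and> \<beta> \<in> carrier B \<and> a \<in> carrier A \<and> b \<in> carrier A}"
    then show "u \<in> ?N"
      by (elim CollectE exE conjE, hypsubst, intro rel) (simp_all add: L2 Lg leibniz)
  next
    fix u assume "u \<in> {(g (t \<alpha> \<one>\<^bsub>A\<^esub>) \<oplus>\<^bsub>FA\<^esub> g (t \<alpha> \<one>\<^bsub>A\<^esub>)) \<ominus>\<^bsub>FA\<^esub> g (t \<one>\<^bsub>B\<^esub> (\<epsilon> \<alpha>)) | \<alpha>. \<alpha> \<in> carrier B}"
    then show "u \<in> ?N"
      by (elim CollectE exE conjE, hypsubst, intro rel) (simp_all add: FA.smult_r_distr La Lg half)
  qed
  from generated_submodule_least[OF Nsub this] have RN: "RA \<subseteq> ?N" .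
  have z1: "L u = \<zero>\<^bsub>P\<^esub>" if "u \<in> RA" for u
  proof -
    have u: "u \<in> carrier FA" and "\<forall>c \<in> carrier A. L (c \<odot>\<^bsub>FA\<^esub> u) = \<zero>\<^bsub>P\<^esub>"
      using subsetD[OF RN that] by blast+
    from bspec[OF this(2) Ar.one_closed] u show ?thesis by simp
  qed
  note h2 = quot_lift_hom[OF FK_mod RA_subK P Lh z1, folded OmK_eq]
    and v2 = quot_lift_coset[OF FK_mod RA_subK P Lh z1, unfolded clsO_K restrict_scalars_simps]
  \<comment> \<open>The scalar 1 is kept from being simplified away so that \<open>Lg\<close> can
    read it as the coefficient.\<close>
  have z2: "quot_lift L u = \<zero>\<^bsub>P\<^esub>" if "u \<in> Exact" for u
    using that unfolding Exact_eq by (elim imageE) (simp add: v2 del: FA.smult_one, simp add: Lg exact del: FA.smult_one)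
  show ?thesis
  proof (rule that)
    show "quot_lift (quot_lift L) \<in> mod_hom K OmQ P"
      by (rule quot_lift_hom[OF OmK_mod Exact_sub P h2 z2])
    fix a x assume "a \<in> carrier A" "x \<in> carrier T"
    moreover from this have "clsO (a \<odot>\<^bsub>FA\<^esub> g x) \<in> carrier OmK"
      by (intro mod_hom_closed[OF clsO_hom]) simp
    ultimately show "quot_lift (quot_lift L) (dform a x) = f a x"
      unfolding dform_def by (simp only: quot_lift_coset[OF OmK_mod Exact_sub P h2 z2]) (simp add: v2 Lg)
  qed
qed

end

section \<open>The isomorphism\<close>

context commutative_triple
begin

lemma hc_class_leibniz:
  assumes "c \<in> carrier A" "\<alpha> \<in> carrier B" "\<beta> \<in> carrier B" "a \<in> carrier A" "b \<in> carrier A"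
  shows "hc_class c (\<alpha> \<otimes>\<^bsub>B\<^esub> \<beta>) (a \<otimes>\<^bsub>A\<^esub> b)
    = hc_class (c \<otimes>\<^bsub>A\<^esub> (a \<otimes>\<^bsub>A\<^esub> \<epsilon> \<alpha>)) \<beta> b \<oplus>\<^bsub>HH\<^esub> hc_class (c \<otimes>\<^bsub>A\<^esub> (b \<otimes>\<^bsub>A\<^esub> \<epsilon> \<beta>)) \<alpha> a"
  using hc_class_hoch[of c \<alpha> \<beta> a "\<one>\<^bsub>B\<^esub>" b] assms by (simp add: Ar.m_ac)

lemma hc_class_half:
  assumes "c \<in> carrier A" "\<alpha> \<in> carrier B"
  shows "hc_class c \<alpha> \<one>\<^bsub>A\<^esub> \<oplus>\<^bsub>HH\<^esub> hc_class c \<alpha> \<one>\<^bsub>A\<^esub> = hc_class c \<one>\<^bsub>B\<^esub> (\<epsilon> \<alpha>)"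
  using hc_class_hoch[of c "\<one>\<^bsub>B\<^esub>" "\<one>\<^bsub>B\<^esub>" "\<one>\<^bsub>A\<^esub>" \<alpha> "\<one>\<^bsub>A\<^esub>"] assms by simp

text \<open>For \<alpha> = 1 the halving rule reads x + x = x with x = [a, 1, 1], so x is zero;
  antisymmetry then carries this over to [1, 1, a].\<close>

lemma hc_class_exact:
  assumes "a \<in> carrier A"
  shows "hc_class \<one>\<^bsub>A\<^esub> \<one>\<^bsub>B\<^esub> a = \<zero>\<^bsub>HH\<^esub>"
proof -
  have "hc_class a \<one>\<^bsub>B\<^esub> \<one>\<^bsub>A\<^esub> = \<zero>\<^bsub>HH\<^esub>"
    using hc_class_half[of a "\<one>\<^bsub>B\<^esub>"] assms by (simp add: H.M.add.l_cancel_one)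
  then show ?thesis
    using hc_class_antisym[of a "\<one>\<^bsub>B\<^esub>" "\<one>\<^bsub>A\<^esub>"] assms by simp
qed

text \<open>The Leibniz rule for the factorization of \<alpha> \<otimes> a into \<alpha> \<otimes> 1
  and 1 \<otimes> a. With the two product rules below, every form is expanded into symbols d(1
  \<otimes> a) and d(\<alpha> \<otimes> 1), where relations can be compared term by term.\<close>

lemma dform_split:
  assumes "c \<in> carrier A" "\<alpha> \<in> carrier B" "a \<in> carrier A"
  shows "dform c (t \<alpha> a) = dform (c \<otimes>\<^bsub>A\<^esub> \<epsilon> \<alpha>) (t \<one>\<^bsub>B\<^esub> a) \<oplus>\<^bsub>OmQ\<^esub> dform (c \<otimes>\<^bsub>A\<^esub> a) (t \<alpha> \<one>\<^bsub>A\<^esub>)"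
  using dform_leibniz[of c \<alpha> "\<one>\<^bsub>B\<^esub>" "\<one>\<^bsub>A\<^esub>" a] assms by simp

lemma dform_A_prod:
  assumes "c \<in> carrier A" "a \<in> carrier A" "b \<in> carrier A"
  shows "dform c (t \<one>\<^bsub>B\<^esub> (a \<otimes>\<^bsub>A\<^esub> b))
    = dform (c \<otimes>\<^bsub>A\<^esub> a) (t \<one>\<^bsub>B\<^esub> b) \<oplus>\<^bsub>OmQ\<^esub> dform (c \<otimes>\<^bsub>A\<^esub> b) (t \<one>\<^bsub>B\<^esub> a)"
  using dform_leibniz[of c "\<one>\<^bsub>B\<^esub>" "\<one>\<^bsub>B\<^esub>" a b] assms by simp

lemma dform_B_prod:
  assumes "c \<in> carrier A" "\<alpha> \<in> carrier B" "\<beta> \<in> carrier B"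
  shows "dform c (t (\<alpha> \<otimes>\<^bsub>B\<^esub> \<beta>) \<one>\<^bsub>A\<^esub>)
    = dform (c \<otimes>\<^bsub>A\<^esub> \<epsilon> \<alpha>) (t \<beta> \<one>\<^bsub>A\<^esub>) \<oplus>\<^bsub>OmQ\<^esub> dform (c \<otimes>\<^bsub>A\<^esub> \<epsilon> \<beta>) (t \<alpha> \<one>\<^bsub>A\<^esub>)"
  using dform_leibniz[of c \<alpha> \<beta> "\<one>\<^bsub>A\<^esub>" "\<one>\<^bsub>A\<^esub>"] assms by simp

text \<open>The sum is the exact form \<open>d(1 \<otimes> a b \<epsilon>(\<alpha>))\<close>, because \<open>2 d(\<alpha> \<otimes> 1) = d(1 \<otimes> \<epsilon>(\<alpha>))\<close>.\<close>

lemma dform_antisym: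
  assumes c: "a \<in> carrier A" "\<alpha> \<in> carrier B" "b \<in> carrier A"
  shows "dform a (t \<alpha> b) \<oplus>\<^bsub>OmQ\<^esub> dform b (t \<alpha> a) = \<zero>\<^bsub>OmQ\<^esub>"
proof -
  let ?p = "\<epsilon> \<alpha>"
  let ?D = "\<lambda>c a. dform c (t \<one>\<^bsub>B\<^esub> a)"
  have "\<zero>\<^bsub>OmQ\<^esub> = ?D \<one>\<^bsub>A\<^esub> ((a \<otimes>\<^bsub>A\<^esub> b) \<otimes>\<^bsub>A\<^esub> ?p)"
    using c by (simp add: dform_exact)
  also have "\<dots> = ?D (a \<otimes>\<^bsub>A\<^esub> b) ?p \<oplus>\<^bsub>OmQ\<^esub> ?D ?p (a \<otimes>\<^bsub>A\<^esub> b)"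
    using c dform_A_prod[of "\<one>\<^bsub>A\<^esub>" "a \<otimes>\<^bsub>A\<^esub> b" ?p] by simp
  also have "?D ?p (a \<otimes>\<^bsub>A\<^esub> b) = ?D (a \<otimes>\<^bsub>A\<^esub> ?p) b \<oplus>\<^bsub>OmQ\<^esub> ?D (b \<otimes>\<^bsub>A\<^esub> ?p) a"
    using c dform_A_prod[of ?p a b] by (simp add: Ar.m_comm)
  \<comment> \<open>Splitting both forms produces ab d(\<alpha> \<otimes> 1) twice;
    \<open>dform_half\<close> read from right to left turns ab d(1 \<otimes> \<epsilon>(\<alpha>))
    from the chain into the same two copies.\<close>
  finally show ?thesis
    using c by (simp add: dform_split[of a] dform_split[of b] dform_half[symmetric]
        OmQ.M.a_ac Ar.m_comm[of b a])
qed

text \<open>Let p, q, r be the images of \<alpha>, \<beta>, \<gamma>. After full expansion the two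
  sides differ in one place only: twice abcpq d(\<gamma> \<otimes> 1) on the left faces abcpq d(1
  \<otimes> r) on the right, which is relation (iii).\<close>

lemma dform_hoch:
  assumes c: "a \<in> carrier A" "\<alpha> \<in> carrier B" "\<beta> \<in> carrier B" "b \<in> carrier A" "\<gamma> \<in> carrier B" "c \<in> carrier A"
  shows "dform (a \<otimes>\<^bsub>A\<^esub> \<epsilon> \<alpha> \<otimes>\<^bsub>A\<^esub> b) (t (\<beta> \<otimes>\<^bsub>B\<^esub> \<gamma>) c)
      \<oplus>\<^bsub>OmQ\<^esub> dform (c \<otimes>\<^bsub>A\<^esub> \<epsilon> \<beta> \<otimes>\<^bsub>A\<^esub> a) (t (\<alpha> \<otimes>\<^bsub>B\<^esub> \<gamma>) b)
    = dform a (t (\<alpha> \<otimes>\<^bsub>B\<^esub> \<beta>) (b \<otimes>\<^bsub>A\<^esub> \<epsilon> \<gamma> \<otimes>\<^bsub>A\<^esub> c))"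
proof -
  let ?p = "\<epsilon> \<alpha>" and ?q = "\<epsilon> \<beta>" and ?r = "\<epsilon> \<gamma>"
  let ?u = "a \<otimes>\<^bsub>A\<^esub> ?p \<otimes>\<^bsub>A\<^esub> b" and ?v = "c \<otimes>\<^bsub>A\<^esub> ?q \<otimes>\<^bsub>A\<^esub> a"
    and ?w = "a \<otimes>\<^bsub>A\<^esub> (?p \<otimes>\<^bsub>A\<^esub> ?q)" and ?z = "b \<otimes>\<^bsub>A\<^esub> ?r \<otimes>\<^bsub>A\<^esub> c"
  show ?thesis
    using c
    by (simp add: dform_split[of ?u _ c] dform_B_prod[of "?u \<otimes>\<^bsub>A\<^esub> c" \<beta> \<gamma>]
        dform_split[of ?v "\<alpha> \<otimes>\<^bsub>B\<^esub> \<gamma>" b] dform_B_prod[of "?v \<otimes>\<^bsub>A\<^esub> b" \<alpha> \<gamma>]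
        dform_split[of a "\<alpha> \<otimes>\<^bsub>B\<^esub> \<beta>" ?z] dform_B_prod[of "a \<otimes>\<^bsub>A\<^esub> ?z" \<alpha> \<beta>]
        dform_A_prod[of ?w "b \<otimes>\<^bsub>A\<^esub> ?r" c] dform_A_prod[of "?w \<otimes>\<^bsub>A\<^esub> c" b ?r]
        dform_half[of "?w \<otimes>\<^bsub>A\<^esub> c \<otimes>\<^bsub>A\<^esub> b" \<gamma>, symmetric])
      (simp add: OmQ.M.a_ac Ar.m_ac)
qed

lemma HC1_isomorphic: "mod_isomorphic K HH OmQ"
proof -
  have "trilin K A A B OmQ (\<lambda>a b \<alpha>. dform a (t \<alpha> b))"
    unfolding trilin_def
    by (auto intro!: dform_hom(1) mod_hom_comp[OF t_hom(2)[OF _ mod_hom_id] dform_hom(2)]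
        mod_hom_comp[OF t_hom(1)[OF mod_hom_id] dform_hom(2)])
  then obtain \<phi> where \<phi>: "\<phi> \<in> mod_hom K HH OmQ"
    and \<phi>v: "\<And>a \<alpha> b. a \<in> carrier A \<Longrightarrow> \<alpha> \<in> carrier B \<Longrightarrow> b \<in> carrier A
      \<Longrightarrow> \<phi> (hc_class a \<alpha> b) = dform a (t \<alpha> b)"
    using HC1_lift_exists[OF OmQ_mod _ dform_antisym dform_hoch] by blast
  \<comment> \<open>The inverse must be prescribed on a d(x) for every x, not just for elementary
    tensors, so \<open>hc_class a\<close> is first extended linearly to the tensor product of
    \<open>B\<close> and \<open>A\<close>.\<close>
  define f where "f a x = tensor_lift K HH (\<lambda>\<alpha> b. hc_class a \<alpha> b) x" for a x
  have bil: "bilin K B A HH (hc_class a)" if "a \<in> carrier A" for a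
    unfolding bilin_def using that hc_class_hom(2)[OF _ mod_hom_id] hc_class_hom(3)[OF _ _ mod_hom_id]
    by auto
  have fv: "f a (t \<alpha> b) = hc_class a \<alpha> b" if "a \<in> carrier A" "\<alpha> \<in> carrier B" "b \<in> carrier A" for a \<alpha> b
    unfolding f_def by (rule tensor_lift_tens[OF modB modA HC1_mod bil[OF that(1)] that(2,3)])
  have "bilin K A T HH f"
    unfolding bilin_def f_def
  proof (intro conjI ballI)
    fix x assume "x \<in> carrier T"
    then show "(\<lambda>a. tensor_lift K HH (hc_class a) x) \<in> mod_hom K A HH"
      by (intro tensor_lift_param[OF modB modA HC1_mod modA bil] hc_class_hom(1)[OF mod_hom_id])
  next
    fix a assume "a \<in> carrier A"
    then show "tensor_lift K HH (hc_class a) \<in> mod_hom K T HH"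
      by (rule tensor_lift_hom[OF modB modA HC1_mod bil])
  qed
  then obtain \<psi> where \<psi>: "\<psi> \<in> mod_hom K OmQ HH"
    and \<psi>v: "\<And>a x. a \<in> carrier A \<Longrightarrow> x \<in> carrier T \<Longrightarrow> \<psi> (dform a x) = f a x"
    by (rule OmQ_lift_exists[OF HC1_mod, where f = f])
      (simp_all add: fv hc_class_leibniz hc_class_half hc_class_exact)
  \<comment> \<open>On generators the two maps exchange [a, \<alpha>, b] and the class of a
    d(\<alpha> \<otimes> b), so they are inverse to each other there.\<close>
  show ?thesis
    by (rule mod_isomorphicI[OF HC1_mod OmQ_mod HC1_spans OmQ_spans \<phi> \<psi>])
      (auto simp: \<phi>v \<psi>v fv)
qed

end

theorem corollary3p5:
  fixes K :: "'k ring" and A :: "('k, 'a) module" and B :: "('k, 'b) module" and \<epsilon> :: "'b \<Rightarrow> 'a"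
  assumes "field K" and "contains_rationals K"
    and "algebra K A" and "algebra K B"
    and "\<epsilon> \<in> algebra_hom K B A"
  shows "mod_isomorphic K (HC1 K A B \<epsilon>)
    (quot_module (restrict_scalars A (Omega K A B \<epsilon>)) (exact_differentials K A B \<epsilon>))"
proof -
  interpret commutative_triple K A B \<epsilon> by (rule commutative_triple.intro) fact+
  show ?thesis by (rule HC1_isomorphic)
qed

end
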